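(* Let $C(\Sigma,I)$ be a fixed right-angled Coxeter group. Then on input $w\in\Sigma^*$ one can calculate in deterministic logspace the alphabet $\widehat{\alpha}(w)$ of the corresponding Coxeter-trace $\widehat{w}$, i.e., the set of letters of $\Sigma$ occurring in $\widehat{w}$.
   Context: An independence alphabet is a pair $(\Sigma,I)$ with $\Sigma$ a finite set and $I\subseteq\Sigma\times\Sigma$ irreflexive and symmetric. The trace monoid is $M(\Sigma,I)=\Sigma^*/\{ab=ba\mid(a,b)\in I\}$; its elements are called traces. The right-angled Coxeter group $C(\Sigma,I)$ is generated by $\Sigma$ with defining relations $a^2=1$ for all $a\in\Sigma$ and $ab=ba$ for all $(a,b)\in I$. A trace $u$ is a factor of a trace $v$ if $v\in M(\Sigma,I)\,u\,M(\Sigma,I)$. A Coxeter-trace is a trace in $M(\Sigma,I)$ that has no factor $a^2$ with $a\in\Sigma$. Every element of $C(\Sigma,I)$ is represented by a unique Coxeter-trace; for a word (or trace) $w$, $\widehat{w}$ denotes the unique Coxeter-trace with $w=\widehat{w}$ in $C(\Sigma,I)$, and $\widehat{\alpha}(w)=\alpha(\widehat{w})$, where $\alpha(t)$ is the set of letters occurring in the trace $t$. Computable in logspace means computable by a deterministic Turing machine with a read-only input tape, a work tape of length $\mathcal{O}(\log n)$ (where $n$ is the input length), and a write-only output tape. The group is fixed and is not part of the input. *)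

theory Defs
  imports "HOL-Algebra.Group" "HOL-Library.Landau_Symbols"
begin

section \<open>Monoids given by presentations\<close>

text \<open>The least congruence on the free monoid \<open>lists A\<close> that contains \<open>R\<close>.\<close>

inductive_set word_cong :: "'a set \<Rightarrow> ('a list \<times> 'a list) set \<Rightarrow> ('a list \<times> 'a list) set"
  for A R where
  rel: "(u, v) \<in> R \<Longrightarrow> u \<in> lists A \<Longrightarrow> v \<in> lists A \<Longrightarrow> x \<in> lists A \<Longrightarrow> y \<in> lists A
    \<Longrightarrow> (x @ u @ y, x @ v @ y) \<in> word_cong A R"
| refl: "u \<in> lists A \<Longrightarrow> (u, u) \<in> word_cong A R"
| sym: "(u, v) \<in> word_cong A R \<Longrightarrow> (v, u) \<in> word_cong A R"
| trans: "(u, v) \<in> word_cong A R \<Longrightarrow> (v, w) \<in> word_cong A R \<Longrightarrow> (u, w) \<in> word_cong A R"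

definition word_class :: "'a set \<Rightarrow> ('a list \<times> 'a list) set \<Rightarrow> 'a list \<Rightarrow> 'a list set" where
  "word_class A R w = word_cong A R `` {w}"

definition presented_monoid ::
    "'a set \<Rightarrow> ('a list \<times> 'a list) set \<Rightarrow> 'a list set monoid" where
  "presented_monoid A R =
    \<lparr>carrier = lists A // word_cong A R,
     monoid.mult = (\<lambda>s t. \<Union>x\<in>s. \<Union>y\<in>t. word_class A R (x @ y)),
     one = word_class A R []\<rparr>"

lemma word_cong_lists: "(u, v) \<in> word_cong A R \<Longrightarrow> u \<in> lists A \<and> v \<in> lists A"
  by (induction rule: word_cong.induct) auto

lemma equiv_word_cong: "equiv (lists A) (word_cong A R)"
proof (rule equivI)
  show "word_cong A R \<subseteq> lists A \<times> lists A"
    using word_cong_lists by fast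
  show "refl_on (lists A) (word_cong A R)"
    by (rule refl_onI) (rule word_cong.refl)
  show "Relation.sym (word_cong A R)"
    by (rule symI) (rule word_cong.sym)
  show "Relation.trans (word_cong A R)"
    by (rule transI) (rule word_cong.trans)
qed

lemma word_cong_context:
  assumes "(u, v) \<in> word_cong A R" and "x \<in> lists A" and "y \<in> lists A"
  shows "(x @ u @ y, x @ v @ y) \<in> word_cong A R"
  using assms
proof (induction rule: word_cong.induct)
  case (rel u v p q)
  then show ?case
    using word_cong.rel[of u v R A "x @ p" "q @ y"] by simp
next
  case (refl u)
  then show ?case by (simp add: word_cong.refl)
next
  case (sym u v)
  show ?case using sym.IH[OF sym.prems] by (rule word_cong.sym)
next
  case (trans u v w)
  then show ?case by (metis word_cong.trans)
qed

lemma word_cong_append: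
  assumes "(u, u') \<in> word_cong A R" and "(v, v') \<in> word_cong A R"
  shows "(u @ v, u' @ v') \<in> word_cong A R"
proof -
  have "(u @ v, u' @ v) \<in> word_cong A R"
    using word_cong_context[OF assms(1), of "[]" v] word_cong_lists[OF assms(2)] by simp
  moreover have "(u' @ v, u' @ v') \<in> word_cong A R"
    using word_cong_context[OF assms(2), of u' "[]"] word_cong_lists[OF assms(1)] by simp
  ultimately show ?thesis
    by (rule word_cong.trans)
qed

lemma word_class_eq_iff:
  "u \<in> lists A \<Longrightarrow> v \<in> lists A \<Longrightarrow>
    word_class A R u = word_class A R v \<longleftrightarrow> (u, v) \<in> word_cong A R"
  unfolding word_class_def by (rule eq_equiv_class_iff[OF equiv_word_cong])

lemma word_class_in_carrier:
  "w \<in> lists A \<Longrightarrow> word_class A R w \<in> carrier (presented_monoid A R)"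
  by (simp add: presented_monoid_def word_class_def quotientI)

lemma carrier_presented_monoidE:
  assumes "g \<in> carrier (presented_monoid A R)"
  obtains w where "w \<in> lists A" and "g = word_class A R w"
  using assms by (auto simp: presented_monoid_def word_class_def quotient_def)

lemma presented_monoid_mult:
  assumes "u \<in> lists A" and "v \<in> lists A"
  shows "word_class A R u \<otimes>\<^bsub>presented_monoid A R\<^esub> word_class A R v = word_class A R (u @ v)"
proof -
  have "word_class A R (x @ y) = word_class A R (u @ v)"
    if "x \<in> word_class A R u" and "y \<in> word_class A R v" for x y
  proof -
    have xy: "(u, x) \<in> word_cong A R" "(v, y) \<in> word_cong A R"
      using that by (auto simp: word_class_def)
    then have "(x @ y, u @ v) \<in> word_cong A R"
      by (rule word_cong.sym[OF word_cong_append])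
    moreover from this have "x @ y \<in> lists A" "u @ v \<in> lists A"
      using word_cong_lists by fast+
    ultimately show ?thesis
      by (simp add: word_class_eq_iff del: append_in_lists_conv)
  qed
  then have "(\<Union>x\<in>word_class A R u. \<Union>y\<in>word_class A R v. word_class A R (x @ y)) =
      (\<Union>x\<in>word_class A R u. \<Union>y\<in>word_class A R v. word_class A R (u @ v))"
    by (intro SUP_cong HOL.refl)
  moreover have "word_class A R u \<noteq> {}" "word_class A R v \<noteq> {}"
    using word_cong.refl[OF assms(1)] word_cong.refl[OF assms(2)]
    unfolding word_class_def by blast+
  ultimately show ?thesis
    by (simp add: presented_monoid_def)
qed

lemma presented_monoid_one: "\<one>\<^bsub>presented_monoid A R\<^esub> = word_class A R []"
  by (simp add: presented_monoid_def)

lemma monoid_presented_monoid: "monoid (presented_monoid A R)"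
proof (rule monoidI)
  let ?M = "presented_monoid A R"
  show "\<one>\<^bsub>?M\<^esub> \<in> carrier ?M"
    by (simp add: presented_monoid_one word_class_in_carrier)
  fix g assume "g \<in> carrier ?M"
  then obtain u where u: "u \<in> lists A" "g = word_class A R u"
    by (rule carrier_presented_monoidE)
  show "\<one>\<^bsub>?M\<^esub> \<otimes>\<^bsub>?M\<^esub> g = g"
    using presented_monoid_mult[of "[]" A u R] u by (simp add: presented_monoid_one)
  show "g \<otimes>\<^bsub>?M\<^esub> \<one>\<^bsub>?M\<^esub> = g"
    using presented_monoid_mult[of u A "[]" R] u by (simp add: presented_monoid_one)
  fix h assume "h \<in> carrier ?M"
  then obtain v where v: "v \<in> lists A" "h = word_class A R v"
    by (rule carrier_presented_monoidE)
  have uv: "u @ v \<in> lists A"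
    using u(1) v(1) by simp
  show "g \<otimes>\<^bsub>?M\<^esub> h \<in> carrier ?M"
    unfolding u(2) v(2) presented_monoid_mult[OF u(1) v(1)] using uv
    by (rule word_class_in_carrier)
  fix k assume "k \<in> carrier ?M"
  then obtain w where w: "w \<in> lists A" "k = word_class A R w"
    by (rule carrier_presented_monoidE)
  have vw: "v @ w \<in> lists A"
    using v(1) w(1) by simp
  show "g \<otimes>\<^bsub>?M\<^esub> h \<otimes>\<^bsub>?M\<^esub> k = g \<otimes>\<^bsub>?M\<^esub> (h \<otimes>\<^bsub>?M\<^esub> k)"
    unfolding u(2) v(2) w(2) presented_monoid_mult[OF u(1) v(1)]
      presented_monoid_mult[OF v(1) w(1)] presented_monoid_mult[OF uv w(1)]
      presented_monoid_mult[OF u(1) vw]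
    by simp
qed


section \<open>Traces and right-angled Coxeter groups\<close>

definition independence_alphabet :: "'a set \<Rightarrow> ('a \<times> 'a) set \<Rightarrow> bool" where
  "independence_alphabet A I \<longleftrightarrow> finite A \<and> I \<subseteq> A \<times> A \<and> irrefl I \<and> sym I"

definition commutations :: "('a \<times> 'a) set \<Rightarrow> ('a list \<times> 'a list) set" where
  "commutations I = {([a, b], [b, a]) | a b. (a, b) \<in> I}"

definition involutions :: "'a set \<Rightarrow> ('a list \<times> 'a list) set" where
  "involutions A = {([a, a], []) | a. a \<in> A}"

definition trace_monoid :: "'a set \<Rightarrow> ('a \<times> 'a) set \<Rightarrow> 'a list set monoid" where
  "trace_monoid A I = presented_monoid A (commutations I)"

definition trace_of :: "'a set \<Rightarrow> ('a \<times> 'a) set \<Rightarrow> 'a list \<Rightarrow> 'a list set" where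
  "trace_of A I w = word_class A (commutations I) w"

text \<open>
  Every generator is its own inverse, so the presentation as a monoid is also the one as a
  group; see \<open>group_coxeter_group\<close> and \<open>coxeter_group_universal\<close> below.
\<close>

definition coxeter_relations :: "'a set \<Rightarrow> ('a \<times> 'a) set \<Rightarrow> ('a list \<times> 'a list) set" where
  "coxeter_relations A I = involutions A \<union> commutations I"

definition coxeter_group :: "'a set \<Rightarrow> ('a \<times> 'a) set \<Rightarrow> 'a list set monoid" where
  "coxeter_group A I = presented_monoid A (coxeter_relations A I)"

definition coxeter_elem :: "'a set \<Rightarrow> ('a \<times> 'a) set \<Rightarrow> 'a list \<Rightarrow> 'a list set" where
  "coxeter_elem A I w = word_class A (coxeter_relations A I) w"

text \<open>
  The canonical homomorphism from the trace monoid onto the Coxeter group; a trace is an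
  equivalence class of words.
\<close>

definition coxeter_elem_of_trace ::
    "'a set \<Rightarrow> ('a \<times> 'a) set \<Rightarrow> 'a list set \<Rightarrow> 'a list set" where
  "coxeter_elem_of_trace A I t = word_cong A (coxeter_relations A I) `` t"

definition factor :: "'a set \<Rightarrow> ('a \<times> 'a) set \<Rightarrow> 'a list set \<Rightarrow> 'a list set \<Rightarrow> bool" where
  "factor A I u v \<longleftrightarrow>
    (\<exists>x\<in>carrier (trace_monoid A I). \<exists>y\<in>carrier (trace_monoid A I).
      v = x \<otimes>\<^bsub>trace_monoid A I\<^esub> u \<otimes>\<^bsub>trace_monoid A I\<^esub> y)"

definition coxeter_trace :: "'a set \<Rightarrow> ('a \<times> 'a) set \<Rightarrow> 'a list set \<Rightarrow> bool" where
  "coxeter_trace A I t \<longleftrightarrow>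
    t \<in> carrier (trace_monoid A I) \<and>
    (\<forall>a\<in>A. \<not> factor A I (trace_of A I [a] [^]\<^bsub>trace_monoid A I\<^esub> (2::nat)) t)"

text \<open>
  Every element of the Coxeter group is represented by exactly one Coxeter-trace, so the
  description below is proper.
\<close>

definition coxeter_trace_of :: "'a set \<Rightarrow> ('a \<times> 'a) set \<Rightarrow> 'a list \<Rightarrow> 'a list set" where
  "coxeter_trace_of A I w =
    (THE t. coxeter_trace A I t \<and> coxeter_elem_of_trace A I t = coxeter_elem A I w)"

text \<open>All words in a trace have the same letters, so the union is that common set.\<close>

definition trace_alphabet :: "'a list set \<Rightarrow> 'a set" where
  "trace_alphabet t = (\<Union>w\<in>t. set w)"

definition coxeter_alphabet :: "'a set \<Rightarrow> ('a \<times> 'a) set \<Rightarrow> 'a list \<Rightarrow> 'a set" where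
  "coxeter_alphabet A I w = trace_alphabet (coxeter_trace_of A I w)"

lemma word_cong_mono: "R \<subseteq> S \<Longrightarrow> (u, v) \<in> word_cong A R \<Longrightarrow> (u, v) \<in> word_cong A S"
proof -
  assume "(u, v) \<in> word_cong A R" and "R \<subseteq> S"
  then show ?thesis
  proof (induction rule: word_cong.induct)
    case (rel u v x y)
    then show ?case by (intro word_cong.rel) auto
  next
    case (refl u)
    then show ?case by (simp add: word_cong.refl)
  next
    case (sym u v)
    show ?case using sym.IH[OF sym.prems] by (rule word_cong.sym)
  next
    case (trans u v w)
    then show ?case by (metis word_cong.trans)
  qed
qed

lemma coxeter_elem_of_trace_trace_of:
  assumes "w \<in> lists A"
  shows "coxeter_elem_of_trace A I (trace_of A I w) = coxeter_elem A I w"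
proof -
  let ?R = "coxeter_relations A I"
  have le: "commutations I \<subseteq> ?R"
    by (simp add: coxeter_relations_def)
  have "(w, v) \<in> word_cong A ?R"
    if "(w, u) \<in> word_cong A (commutations I)" "(u, v) \<in> word_cong A ?R" for u v
    using word_cong_mono[OF le that(1)] that(2) by (rule word_cong.trans)
  moreover have "(w, w) \<in> word_cong A (commutations I)"
    using assms by (rule word_cong.refl)
  ultimately show ?thesis
    unfolding coxeter_elem_of_trace_def trace_of_def coxeter_elem_def word_class_def by blast
qed

lemma trace_alphabet_trace_of:
  assumes "w \<in> lists A"
  shows "trace_alphabet (trace_of A I w) = set w"
proof -
  have "set u = set v" if "(u, v) \<in> word_cong A (commutations I)" for u v
    using that by (induction rule: word_cong.induct) (auto simp: commutations_def)
  with assms show ?thesis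
    unfolding trace_alphabet_def trace_of_def word_class_def
    by (auto intro: word_cong.refl)
qed

lemma coxeter_elem_rev:
  assumes "w \<in> lists A"
  shows "(rev w @ w, []) \<in> word_cong A (coxeter_relations A I)"
  using assms
proof (induction w)
  case Nil
  then show ?case by (auto intro: word_cong.refl)
next
  case (Cons a w)
  then have "(rev w @ [a, a] @ w, rev w @ [] @ w) \<in> word_cong A (coxeter_relations A I)"
    by (intro word_cong.rel) (auto simp: coxeter_relations_def involutions_def)
  then have "(rev (a # w) @ a # w, rev w @ w) \<in> word_cong A (coxeter_relations A I)"
    by simp
  then show ?case
    using Cons.IH by (rule word_cong.trans)
qed

theorem group_coxeter_group: "group (coxeter_group A I)"
proof (rule group.intro)
  show "monoid (coxeter_group A I)"
    by (simp add: coxeter_group_def monoid_presented_monoid)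
  show "group_axioms (coxeter_group A I)"
  proof (rule group_axioms.intro, rule subsetI)
    fix g assume g: "g \<in> carrier (coxeter_group A I)"
    let ?R = "coxeter_relations A I"
    obtain w where w: "w \<in> lists A" "g = word_class A ?R w"
      using g unfolding coxeter_group_def by (elim carrier_presented_monoidE)
    have r: "rev w \<in> lists A" using w(1) by auto
    have "(rev w @ w, []) \<in> word_cong A ?R" "(w @ rev w, []) \<in> word_cong A ?R"
      using coxeter_elem_rev[OF w(1)] coxeter_elem_rev[OF r] by simp_all
    then have "word_class A ?R (rev w @ w) = word_class A ?R []"
      "word_class A ?R (w @ rev w) = word_class A ?R []"
      using w(1) r by (simp_all add: word_class_eq_iff)
    moreover have "word_class A ?R (rev w) \<in> carrier (presented_monoid A ?R)"
      using r by (rule word_class_in_carrier)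
    ultimately show "g \<in> Units (coxeter_group A I)"
      using g presented_monoid_mult[OF w(1) r] presented_monoid_mult[OF r w(1)]
      unfolding Units_def coxeter_group_def w(2) presented_monoid_one by force
  qed
qed

theorem coxeter_group_universal:
  fixes G (structure) and f :: "'a \<Rightarrow> 'g"
  assumes "group G" and f: "f \<in> A \<rightarrow> carrier G"
    and inv: "\<And>a. a \<in> A \<Longrightarrow> f a \<otimes> f a = \<one>"
    and comm: "\<And>a b. (a, b) \<in> I \<Longrightarrow> f a \<otimes> f b = f b \<otimes> f a"
  shows "\<exists>h\<in>hom (coxeter_group A I) G. \<forall>a\<in>A. h (coxeter_elem A I [a]) = f a"
proof -
  interpret group G by fact
  let ?R = "coxeter_relations A I"
  define e where "e w = foldr (\<lambda>a g. f a \<otimes> g) w \<one>" for w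
  have e_simps [simp]: "e [] = \<one>" "e (a # w) = f a \<otimes> e w" for a w
    by (simp_all add: e_def)
  have e_closed [simp]: "e w \<in> carrier G" if "w \<in> lists A" for w
    using that f by (induction w) auto
  have e_append: "e (u @ v) = e u \<otimes> e v" if "u \<in> lists A" "v \<in> lists A" for u v
    using that f by (induction u) (auto simp: m_assoc Pi_iff)
  have e_rel: "e u = e v" if "(u, v) \<in> ?R" "u \<in> lists A" "v \<in> lists A" for u v
    using that f inv comm
    by (auto simp: coxeter_relations_def involutions_def commutations_def Pi_iff)
  have e_cong: "e u = e v" if "(u, v) \<in> word_cong A ?R" for u v
    using that
  proof (induction rule: word_cong.induct)
    case (rel u v x y)
    then show ?case
      using e_rel[of u v] by (simp add: e_append)
  qed auto
  define h where "h g = e (SOME w. w \<in> g)" for g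
  have h_class: "h (word_class A ?R w) = e w" if "w \<in> lists A" for w
  proof -
    have "w \<in> word_class A ?R w"
      using that by (auto simp: word_class_def intro: word_cong.refl)
    then have "(SOME v. v \<in> word_class A ?R w) \<in> word_class A ?R w"
      by (rule someI)
    then show ?thesis
      unfolding h_def word_class_def by (auto dest: e_cong)
  qed
  have "h \<in> hom (coxeter_group A I) G"
    unfolding coxeter_group_def
  proof (rule homI)
    fix x assume "x \<in> carrier (presented_monoid A ?R)"
    then obtain u where u: "u \<in> lists A" "x = word_class A ?R u"
      by (rule carrier_presented_monoidE)
    then show "h x \<in> carrier G"
      using e_closed[OF u(1)] h_class[OF u(1)] by simp
    fix y assume "y \<in> carrier (presented_monoid A ?R)"
    then obtain v where v: "v \<in> lists A" "y = word_class A ?R v"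
      by (rule carrier_presented_monoidE)
    have uv: "u @ v \<in> lists A"
      using u(1) v(1) by simp
    show "h (x \<otimes>\<^bsub>presented_monoid A ?R\<^esub> y) = h x \<otimes> h y"
      unfolding u(2) v(2) presented_monoid_mult[OF u(1) v(1)]
        h_class[OF u(1)] h_class[OF v(1)] h_class[OF uv]
      using u(1) v(1) by (rule e_append)
  qed
  moreover have "h (coxeter_elem A I [a]) = f a" if "a \<in> A" for a
    using that f by (auto simp: coxeter_elem_def h_class Pi_iff)
  ultimately show ?thesis by blast
qed


section \<open>Logspace computability\<close>

text \<open>
  Deterministic Turing machines with a read-only input tape, one work tape and a write-only
  output tape.  On input \<open>w\<close> the cells \<open>0, \<dots>, length w + 1\<close> of the input tape hold \<open>w\<close> between
  two end markers.  The work tape is infinite to the right and initially blank.  One step reads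
  both heads, writes to the work tape, moves both heads by at most one cell, and appends at most
  one symbol to the output.
\<close>

datatype 'i cell = Left_End | Letter 'i | Right_End

datatype move = Move_Left | Stay | Move_Right

record ('q, 's, 'i, 'o) transducer =
  states :: "'q set"
  work_symbols :: "'s set"
  start :: 'q
  halting :: "'q set"
  blank :: 's
  transition :: "'q \<Rightarrow> 'i cell \<Rightarrow> 's \<Rightarrow> 'q \<times> 's \<times> move \<times> move \<times> 'o option"

record ('q, 's, 'o) config =
  state :: 'q
  input_pos :: nat
  work_tape :: "nat \<Rightarrow> 's"
  work_pos :: nat
  output_tape :: "'o list"

definition input_cells :: "'i set \<Rightarrow> 'i cell set" where
  "input_cells A = {Left_End, Right_End} \<union> Letter ` A"

definition transducer ::
    "'i set \<Rightarrow> 'o set \<Rightarrow> ('q, 's, 'i, 'o) transducer \<Rightarrow> bool" where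
  "transducer A B M \<longleftrightarrow>
    finite A \<and> finite B \<and> finite (states M) \<and> finite (work_symbols M) \<and>
    start M \<in> states M \<and> halting M \<subseteq> states M \<and> blank M \<in> work_symbols M \<and>
    (\<forall>q\<in>states M. \<forall>c\<in>input_cells A. \<forall>s\<in>work_symbols M.
      case transition M q c s of (q', s', d, e, out) \<Rightarrow>
        q' \<in> states M \<and> s' \<in> work_symbols M \<and> set_option out \<subseteq> B)"

definition input_cell :: "'i list \<Rightarrow> nat \<Rightarrow> 'i cell" where
  "input_cell w p =
    (if p = 0 then Left_End else if p \<le> length w then Letter (w ! (p - 1)) else Right_End)"

text \<open>A left move in cell 0 leaves the head where it is.\<close>

fun move_head :: "move \<Rightarrow> nat \<Rightarrow> nat" where
  "move_head Move_Left p = p - 1"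
| "move_head Stay p = p"
| "move_head Move_Right p = p + 1"

definition initial_config :: "('q, 's, 'i, 'o) transducer \<Rightarrow> ('q, 's, 'o) config" where
  "initial_config M =
    \<lparr>state = start M, input_pos = 0, work_tape = (\<lambda>_. blank M), work_pos = 0, output_tape = []\<rparr>"

definition step ::
    "('q, 's, 'i, 'o) transducer \<Rightarrow> 'i list \<Rightarrow> ('q, 's, 'o) config \<Rightarrow> ('q, 's, 'o) config" where
  "step M w c =
    (if state c \<in> halting M then c
     else case transition M (state c) (input_cell w (input_pos c)) (work_tape c (work_pos c)) of
       (q, s, d, e, out) \<Rightarrow>
         \<lparr>state = q,
          input_pos = min (length w + 1) (move_head d (input_pos c)),
          work_tape = (work_tape c)(work_pos c := s),
          work_pos = move_head e (work_pos c),
          output_tape = output_tape c @ (case out of None \<Rightarrow> [] | Some b \<Rightarrow> [b])\<rparr>)"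

definition run ::
    "('q, 's, 'i, 'o) transducer \<Rightarrow> 'i list \<Rightarrow> nat \<Rightarrow> ('q, 's, 'o) config" where
  "run M w k = (step M w ^^ k) (initial_config M)"

definition computes ::
    "('q, 's, 'i, 'o) transducer \<Rightarrow> 'i set \<Rightarrow> ('i list \<Rightarrow> 'o list) \<Rightarrow> bool" where
  "computes M A f \<longleftrightarrow>
    (\<forall>w\<in>lists A. \<exists>k. state (run M w k) \<in> halting M \<and> output_tape (run M w k) = f w)"

text \<open>On inputs of length \<open>n\<close> only the first \<open>S n\<close> cells of the work tape are visited.\<close>

definition works_in_space ::
    "('q, 's, 'i, 'o) transducer \<Rightarrow> 'i set \<Rightarrow> (nat \<Rightarrow> nat) \<Rightarrow> bool" where
  "works_in_space M A S \<longleftrightarrow> (\<forall>w\<in>lists A. \<forall>k. work_pos (run M w k) < S (length w))"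

text \<open>
  States and work symbols are taken from \<^typ>\<open>nat\<close>; as both sets are finite, this is no
  restriction.
\<close>

definition logspace_computable ::
    "'i set \<Rightarrow> 'o set \<Rightarrow> ('i list \<Rightarrow> 'o list) \<Rightarrow> bool" where
  "logspace_computable A B f \<longleftrightarrow>
    (\<exists>(M :: (nat, nat, 'i, 'o) transducer) S.
      transducer A B M \<and> computes M A f \<and> works_in_space M A S \<and>
      (\<lambda>n. real (S n)) \<in> O(\<lambda>n. ln (real n)))"

end

theory Submission
  imports Defs "HOL-Real_Asymp.Real_Asymp"
begin

text \<open>
  The Coxeter group acts on integer vectors indexed by \<open>A\<close>, where the generator \<open>a\<close> replaces the
  coordinate \<open>n a\<close> by \<open>1 - n a + 2 * (\<Sum>b. n b)\<close>, the sum being over all \<open>b \<noteq> a\<close> that do not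
  commute with \<open>a\<close>.  Let \<open>weight w\<close> be the image of the zero vector under \<open>w\<close>.  Along a reduced
  word every letter strictly increases its own coordinate, so the letters of the Coxeter-trace of
  \<open>w\<close> are exactly the \<open>a\<close> with \<open>weight w a \<noteq> 0\<close>.  The first letters of a reduced word
  can also be read off from its weight, which makes the Coxeter-trace unique.

  The coordinates have linearly many bits in the length of \<open>w\<close>.  As the least common multiple of
  \<open>1, \<dots>, N\<close> is exponentially large in \<open>N\<close>, a coordinate vanishes if and only if it vanishes modulo
  all \<open>m\<close> up to some linear bound, and a Turing machine with logarithmic space can compute the
  coordinates modulo one such \<open>m\<close> after the other.
\<close>

section \<open>An affine action that detects the letters of a Coxeter-trace\<close>

locale alphabet =
  fixes A :: "'a set" and I :: "('a \<times> 'a) set"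
  assumes independence_alphabet: "independence_alphabet A I"
begin

abbreviation trace_eq :: "'a list \<Rightarrow> 'a list \<Rightarrow> bool" (infix "\<sim>" 50) where
  "u \<sim> v \<equiv> (u, v) \<in> word_cong A (commutations I)"

abbreviation coxeter_eq :: "'a list \<Rightarrow> 'a list \<Rightarrow> bool" (infix "\<approx>" 50) where
  "u \<approx> v \<equiv> (u, v) \<in> word_cong A (coxeter_relations A I)"

lemma finite_A: "finite A" and I_subset: "(a, b) \<in> I \<Longrightarrow> a \<in> A \<and> b \<in> A"
  and I_irrefl: "(a, a) \<notin> I" and I_sym: "(a, b) \<in> I \<Longrightarrow> (b, a) \<in> I"
  using independence_alphabet
  by (auto simp: independence_alphabet_def irrefl_def dest: symD)

text \<open>The neighbours of \<open>a\<close> in the Coxeter graph, where every edge has label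
  infinity.\<close>

definition dependent :: "'a \<Rightarrow> 'a set" where
  "dependent a = {b \<in> A. b \<noteq> a \<and> (a, b) \<notin> I}"

lemma finite_dependent: "finite (dependent a)"
  using finite_A by (simp add: dependent_def)

lemma dependent_sym: "a \<in> A \<Longrightarrow> b \<in> dependent a \<Longrightarrow> a \<in> dependent b"
  using I_sym by (auto simp: dependent_def)

definition slope :: "'a \<Rightarrow> ('a \<Rightarrow> int) \<Rightarrow> int" where
  "slope a n = 1 - 2 * n a + 2 * (\<Sum>b\<in>dependent a. n b)"

definition reflect :: "'a \<Rightarrow> ('a \<Rightarrow> int) \<Rightarrow> 'a \<Rightarrow> int" where
  "reflect a n = n(a := n a + slope a n)"

text \<open>
  If \<open>\<rho>\<close> is the weight that takes the value 1 on every simple coroot, then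
  \<open>w \<rho> = \<rho> - (\<Sum>a. weight w a * e a)\<close> in the geometric representation, and \<open>slope a (weight w)\<close>
  is the pairing of \<open>w \<rho>\<close> with the coroot of \<open>a\<close>.
\<close>

definition weight :: "'a list \<Rightarrow> 'a \<Rightarrow> int" where
  "weight w = foldr reflect w (\<lambda>_. 0)"

lemma weight_simps [simp]:
  "weight [] = (\<lambda>_. 0)" "weight (a # w) = reflect a (weight w)"
  by (simp_all add: weight_def)

lemma reflect_eq: "reflect a n = n(a := 1 - n a + 2 * (\<Sum>b\<in>dependent a. n b))"
  by (auto simp: reflect_def slope_def)

lemma sum_dependent_upd:
  "(\<Sum>d\<in>dependent a. (n(b := x)) d) =
    (\<Sum>d\<in>dependent a. n d) + (if b \<in> dependent a then x - n b else (0::int))"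
proof (cases "b \<in> dependent a")
  case True
  then have "(\<Sum>d\<in>dependent a. (n(b := x)) d) = x + (\<Sum>d\<in>dependent a - {b}. n d)"
    by (subst sum.remove[OF finite_dependent True]) auto
  then show ?thesis
    using True by (simp add: sum.remove[OF finite_dependent True])
next
  case False
  then have "(\<Sum>d\<in>dependent a. (n(b := x)) d) = (\<Sum>d\<in>dependent a. n d)"
    by (intro sum.cong) auto
  then show ?thesis using False by simp
qed

text \<open>These are the entries of the Cartan matrix: 2 on the diagonal, -2 for dependent letters,
  0 for commuting ones.\<close>

lemma slope_reflect:
  "slope a (reflect b n) =
    (if a = b then - slope b n else if b \<in> dependent a then slope a n + 2 * slope b n
     else slope a n)"
proof -
  have "a \<notin> dependent a" by (simp add: dependent_def)
  then show ?thesis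
    unfolding slope_def[of a] reflect_def sum_dependent_upd
    by (auto simp: slope_def)
qed

lemma reflect_involution: "reflect a (reflect a n) = n"
  by (subst reflect_def) (simp add: slope_reflect, simp add: reflect_def)

lemma reflect_commute:
  assumes "(a, b) \<in> I"
  shows "reflect a (reflect b n) = reflect b (reflect a n)"
proof -
  have "a \<noteq> b" "a \<notin> dependent b" "b \<notin> dependent a"
    using assms I_irrefl I_sym by (auto simp: dependent_def)
  then have "slope a (reflect b n) = slope a n" "slope b (reflect a n) = slope b n"
    by (simp_all add: slope_reflect)
  with \<open>a \<noteq> b\<close> show ?thesis
    unfolding reflect_def[of a "reflect b n"] reflect_def[of b "reflect a n"]
    by (auto simp: reflect_def)
qed

lemma coxeter_eq_weight: "u \<approx> v \<Longrightarrow> weight u = weight v"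
proof -
  assume "u \<approx> v"
  \<comment> \<open>The induction is on the whole action, since in \<open>x @ u @ y\<close> the word
    \<open>u\<close> meets an arbitrary vector produced by \<open>y\<close>.\<close>
  then have "foldr reflect u = foldr reflect v"
  proof (induction rule: word_cong.induct)
    case (rel u v x y)
    then have "foldr reflect u n = foldr reflect v n" for n
      using reflect_commute[of _ _ n]
      by (auto simp: coxeter_relations_def involutions_def commutations_def reflect_involution)
    then have "foldr reflect u = foldr reflect v" by (rule ext)
    then show ?case by simp
  qed auto
  then show ?thesis by (simp add: weight_def)
qed

section \<open>Reduced words and their slopes\<close>

lemma trace_eq_coxeter_eq: "u \<sim> v \<Longrightarrow> u \<approx> v"
  by (rule word_cong_mono) (auto simp: coxeter_relations_def)

lemma trace_eq_length: "u \<sim> v \<Longrightarrow> length u = length v"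
  by (induction rule: word_cong.induct) (auto simp: commutations_def)

lemma trace_eq_Cons: "u \<sim> v \<Longrightarrow> a \<in> A \<Longrightarrow> a # u \<sim> a # v"
  using word_cong_context[of u v A _ "[a]" "[]"] by simp

lemma trace_eq_swap: "(a, b) \<in> I \<Longrightarrow> w \<in> lists A \<Longrightarrow> a # b # w \<sim> b # a # w"
  using word_cong.rel[of "[a, b]" "[b, a]" "commutations I" A "[]" w] I_subset
  by (auto simp: commutations_def)

definition reduced :: "'a list \<Rightarrow> bool" where
  "reduced w \<longleftrightarrow> w \<in> lists A \<and> (\<forall>x a y. \<not> w \<sim> x @ [a, a] @ y)"

lemma reduced_trace_eq: "u \<sim> v \<Longrightarrow> reduced u \<longleftrightarrow> reduced v"
  unfolding reduced_def by (meson word_cong.sym word_cong.trans word_cong_lists)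

lemma reduced_ConsD:
  assumes "reduced (a # w)"
  shows "reduced w" "\<not> w \<sim> a # v"
proof -
  have w: "a \<in> A" "w \<in> lists A"
    using assms by (auto simp: reduced_def)
  have "\<not> w \<sim> x @ [b, b] @ y" for x b y
    using trace_eq_Cons[OF _ w(1), of w "x @ [b, b] @ y"] assms
    unfolding reduced_def by (metis append_Cons)
  with w show "reduced w" by (simp add: reduced_def)
  show "\<not> w \<sim> a # v"
    using trace_eq_Cons[OF _ w(1), of w "a # v"] assms
    unfolding reduced_def by (metis append_Cons append_Nil)
qed

text \<open>The two claims need each other. In a reduced word \<open>c # w\<close>, the second claim
  for \<open>w\<close> forces \<open>slope c (weight w)\<close> to be positive, as otherwise
  \<open>w\<close> could start with \<open>c\<close>. Applying \<open>c\<close> negates this slope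
  and adds it twice to the dependent ones. By the first claim, dependent letters then get positive
  slopes, and commuting first letters of \<open>w\<close> move past \<open>c\<close>.\<close>

lemma reduced_slopes:
  assumes "reduced w"
  shows slope_dependent_pos:
      "\<lbrakk>a \<in> A; b \<in> dependent a\<rbrakk> \<Longrightarrow> 0 < slope a (weight w) + slope b (weight w)"
    and slope_nonpos_first: "\<lbrakk>a \<in> A; slope a (weight w) \<le> 0\<rbrakk> \<Longrightarrow> \<exists>v. w \<sim> a # v"
  using assms
proof (induction w arbitrary: a b)
  case Nil
  { case 1 then show ?case by (simp add: slope_def) }
  { case 2 then show ?case by (simp add: slope_def) }
next
  case (Cons c w)
  { case 1
    note red = reduced_ConsD[OF 1(3)]
    have c: "c \<in> A" "w \<in> lists A" using 1(3) by (auto simp: reduced_def)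
    have pos: "0 < slope c (weight w)"
      using Cons.IH(2)[OF c(1) _ red(1)] red(2) by force
    have ab: "a \<noteq> b" "b \<in> A" "a \<in> dependent b" using 1 dependent_sym by (auto simp: dependent_def)
    have IH: "0 < slope a (weight w) + slope b (weight w)"
      using Cons.IH(1)[OF 1(1,2) red(1)] .
    \<comment> \<open>If \<open>c\<close> is \<open>a\<close> or \<open>b\<close>, the sum of the
      two slopes is unchanged; otherwise neither slope decreases.\<close>
    show ?case
      using IH pos ab 1(2) by (auto simp: slope_reflect) }
  { case 2
    note red = reduced_ConsD[OF 2(3)]
    have c: "c \<in> A" "w \<in> lists A" using 2(3) by (auto simp: reduced_def)
    have pos: "0 < slope c (weight w)"
      using Cons.IH(2)[OF c(1) _ red(1)] red(2) by force
    consider "a = c" | "a \<noteq> c" "c \<in> dependent a" | "a \<noteq> c" "c \<notin> dependent a" by blast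
    then show ?case
    proof cases
      case 1
      then show ?thesis using c by (intro exI[of _ w]) (simp add: word_cong.refl)
    next
      case 2
      then show ?thesis
        using \<open>slope a (weight (c # w)) \<le> 0\<close> pos Cons.IH(1)[OF \<open>a \<in> A\<close> 2(2) red(1)]
        by (simp add: slope_reflect)
    next
      case 3
      then have ac: "(c, a) \<in> I"
        using c 2(1) I_sym by (auto simp: dependent_def)
      obtain v where v: "w \<sim> a # v"
        using Cons.IH(2)[OF 2(1) _ red(1)] 2(2) 3 by (auto simp: slope_reflect)
      then have "v \<in> lists A" using word_cong_lists by fastforce
      then have "c # w \<sim> a # c # v"
        using trace_eq_Cons[OF v c(1)] trace_eq_swap[OF ac] by (meson word_cong.trans)
      then show ?thesis by blast
    qed }
qed

lemma reduced_Cons_slope_pos: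
  assumes "reduced (a # w)"
  shows "0 < slope a (weight w)"
  using slope_nonpos_first[OF reduced_ConsD(1)[OF assms], of a] reduced_ConsD(2)[OF assms] assms
  by (force simp: reduced_def)

lemma reduced_weight_nonneg: "reduced w \<Longrightarrow> 0 \<le> weight w a"
proof (induction w)
  case (Cons b w)
  then show ?case
    using reduced_ConsD(1)[OF Cons.prems] reduced_Cons_slope_pos[OF Cons.prems]
    by (auto simp: reflect_def)
qed simp

lemma reduced_weight_nonzero_iff: "reduced w \<Longrightarrow> weight w a \<noteq> 0 \<longleftrightarrow> a \<in> set w"
proof (induction w)
  case (Cons b w)
  then show ?case
    using reduced_ConsD(1)[OF Cons.prems] reduced_Cons_slope_pos[OF Cons.prems]
      reduced_weight_nonneg[of w a]
    by (auto simp: reflect_def)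
qed simp

text \<open>The first letter \<open>a\<close> of \<open>u\<close> has negative slope after it has
  been applied. The same slope belongs to \<open>v\<close>, so \<open>v\<close> can be brought to
  start with \<open>a\<close>, and the two letters cancel.\<close>

lemma reduced_unique:
  assumes "reduced u" and "reduced v" and "weight u = weight v"
  shows "u \<sim> v"
  using assms
proof (induction u arbitrary: v)
  case Nil
  show ?case
  proof (cases v)
    case Nil
    then show ?thesis by (auto intro: word_cong.refl)
  next
    case (Cons a v')
    have "slope a (weight v) < 0"
      using reduced_Cons_slope_pos[of a v'] Nil Cons by (simp add: slope_reflect)
    moreover have "slope a (weight v) = 1"
      by (simp flip: Nil(3) add: slope_def)
    ultimately show ?thesis by simp
  qed
next
  case (Cons a u)
  have a: "a \<in> A" using Cons.prems(1) by (simp add: reduced_def)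
  have "slope a (weight v) < 0"
    using reduced_Cons_slope_pos[OF Cons.prems(1)] Cons.prems(3)[symmetric]
    by (simp add: slope_reflect)
  then obtain v' where v': "v \<sim> a # v'"
    using slope_nonpos_first[OF Cons.prems(2) a] by auto
  have red: "reduced (a # v')"
    using reduced_trace_eq[OF v'] Cons.prems(2) by simp
  have "reflect a (weight u) = reflect a (weight v')"
    using coxeter_eq_weight[OF trace_eq_coxeter_eq[OF v']] Cons.prems(3) by simp
  then have "weight u = weight v'"
    by (metis reflect_involution)
  then have "u \<sim> v'"
    using Cons.IH reduced_ConsD(1)[OF Cons.prems(1)] reduced_ConsD(1)[OF red] by blast
  then show ?case
    using trace_eq_Cons[OF _ a] v' by (meson word_cong.sym word_cong.trans)
qed

lemma reduced_exists: "w \<in> lists A \<Longrightarrow> \<exists>u. reduced u \<and> w \<approx> u"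
proof (induction w rule: length_induct)
  case (1 w)
  show ?case
  proof (cases "reduced w")
    case True
    then show ?thesis using 1(2) by (auto intro: word_cong.refl)
  next
    case False
    then obtain x a y where w: "w \<sim> x @ [a, a] @ y"
      using 1(2) by (auto simp: reduced_def)
    then have xy: "x \<in> lists A" "y \<in> lists A" "a \<in> A" "x @ y \<in> lists A"
      using word_cong_lists by fastforce+
    have "x @ [a, a] @ y \<approx> x @ [] @ y"
      using xy by (intro word_cong.rel) (auto simp: coxeter_relations_def involutions_def)
    then have "w \<approx> x @ y"
      using trace_eq_coxeter_eq[OF w] by (auto intro: word_cong.trans)
    moreover have "length (x @ y) < length w"
      using trace_eq_length[OF w] by simp
    ultimately show ?thesis
      using 1(1) xy(4) by (meson word_cong.trans)
  qed
qed

section \<open>Coxeter-traces and their alphabets\<close>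

lemma coxeter_trace_trace_of:
  assumes "w \<in> lists A"
  shows "coxeter_trace A I (trace_of A I w) \<longleftrightarrow> reduced w"
proof -
  let ?R = "commutations I"
  let ?M = "presented_monoid A ?R"
  interpret M: monoid ?M by (rule monoid_presented_monoid)
  have square: "word_class A ?R [a] [^]\<^bsub>?M\<^esub> (2::nat) = word_class A ?R [a, a]"
    if "a \<in> A" for a
    using that word_class_in_carrier[of "[a]" A ?R] presented_monoid_mult[of "[a]" A "[a]" ?R]
    by (simp add: numeral_2_eq_2)
  \<comment> \<open>A factor of a trace shows up as a contiguous subword of some word in that trace,
    so squares can be sought in words.\<close>
  have "factor A I (word_class A ?R [a, a]) (word_class A ?R w) \<longleftrightarrow> (\<exists>x y. w \<sim> x @ [a, a] @ y)"
    (is "?l \<longleftrightarrow> ?r") if "a \<in> A" for a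
  proof
    assume ?l
    then obtain g h where "g \<in> carrier ?M" "h \<in> carrier ?M"
      and wgh: "word_class A ?R w = g \<otimes>\<^bsub>?M\<^esub> word_class A ?R [a, a] \<otimes>\<^bsub>?M\<^esub> h"
      by (auto simp: factor_def trace_monoid_def)
    then obtain x y where xy: "x \<in> lists A" "g = word_class A ?R x"
      "y \<in> lists A" "h = word_class A ?R y"
      by (metis carrier_presented_monoidE)
    then have "word_class A ?R w = word_class A ?R (x @ [a, a] @ y)"
      using wgh presented_monoid_mult[of x A "[a, a]" ?R]
        presented_monoid_mult[of "x @ [a, a]" A y ?R] that
      by simp
    then show ?r
      using word_class_eq_iff[of w A "x @ [a, a] @ y" ?R] assms xy that by auto
  next
    assume ?r
    then obtain x y where w: "w \<sim> x @ [a, a] @ y" by blast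
    then have xy: "x \<in> lists A" "y \<in> lists A"
      using word_cong_lists by fastforce+
    have "word_class A ?R w = word_class A ?R (x @ [a, a] @ y)"
      using w word_class_eq_iff[of w A "x @ [a, a] @ y" ?R] assms xy that by auto
    also have "\<dots> = word_class A ?R x \<otimes>\<^bsub>?M\<^esub> word_class A ?R [a, a] \<otimes>\<^bsub>?M\<^esub> word_class A ?R y"
      using presented_monoid_mult[of x A "[a, a]" ?R]
        presented_monoid_mult[of "x @ [a, a]" A y ?R] that xy
      by simp
    finally show ?l
      using xy by (auto simp: factor_def trace_monoid_def intro: word_class_in_carrier)
  qed
  moreover have "a \<in> A" if "w \<sim> x @ [a, a] @ y" for x a y
    using word_cong_lists[OF that] by simp
  moreover have "coxeter_trace A I (trace_of A I w) \<longleftrightarrow>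
      (\<forall>a\<in>A. \<not> factor A I (word_class A ?R [a, a]) (word_class A ?R w))"
    using square word_class_in_carrier[OF assms, of ?R]
    by (simp add: coxeter_trace_def trace_monoid_def trace_of_def)
  ultimately show ?thesis
    using assms unfolding reduced_def by blast
qed

theorem coxeter_alphabet_weight:
  assumes w: "w \<in> lists A"
  shows "coxeter_alphabet A I w = {a. weight w a \<noteq> 0}"
proof -
  obtain u where u: "reduced u" "w \<approx> u"
    using reduced_exists[OF w] by blast
  then have uA: "u \<in> lists A" by (simp add: reduced_def)
  \<comment> \<open>Uniqueness holds because every Coxeter-trace of this group element has the
    weight of \<open>w\<close>, which determines a reduced word up to commutations.\<close>
  have "coxeter_trace_of A I w = trace_of A I u"
    unfolding coxeter_trace_of_def
  proof (rule the_equality)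
    have "coxeter_elem A I u = coxeter_elem A I w"
      unfolding coxeter_elem_def
      using u(2) w uA word_class_eq_iff[of u A w] by (blast intro: word_cong.sym)
    with u(1) uA show "coxeter_trace A I (trace_of A I u) \<and>
        coxeter_elem_of_trace A I (trace_of A I u) = coxeter_elem A I w"
      by (simp add: coxeter_trace_trace_of coxeter_elem_of_trace_trace_of)
    fix t
    assume t: "coxeter_trace A I t \<and> coxeter_elem_of_trace A I t = coxeter_elem A I w"
    then have "t \<in> carrier (presented_monoid A (commutations I))"
      by (simp add: coxeter_trace_def trace_monoid_def)
    then obtain v where v: "v \<in> lists A" "t = trace_of A I v"
      unfolding trace_of_def by (rule carrier_presented_monoidE)
    have "v \<approx> w"
      using t v w word_class_eq_iff[of v A w]
      by (simp add: coxeter_elem_of_trace_trace_of coxeter_elem_def)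
    then have "weight v = weight u"
      using coxeter_eq_weight u(2) by metis
    then have "v \<sim> u"
      using t v u(1) by (intro reduced_unique) (simp_all add: coxeter_trace_trace_of)
    then show "t = trace_of A I u"
      using v uA word_class_eq_iff[of v A u] by (simp add: trace_of_def)
  qed
  then have "coxeter_alphabet A I w = set u"
    by (simp add: coxeter_alphabet_def trace_alphabet_trace_of[OF uA])
  also have "\<dots> = {a. weight u a \<noteq> 0}"
    using reduced_weight_nonzero_iff[OF u(1)] by blast
  finally show ?thesis
    using coxeter_eq_weight[OF u(2)] by simp
qed

text \<open>One letter combines 1, a coordinate and twice a sum of at most \<open>card A\<close>
  coordinates, so a bound grows by the factor \<open>2 * card A + 2\<close> per letter.\<close>

lemma abs_weight_less:
  assumes "w \<in> lists A"
  shows "\<bar>weight w a\<bar> < (2 * int (card A) + 2) ^ length w"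
  using assms
proof (induction w arbitrary: a)
  case (Cons b w)
  let ?k = "int (card A)" and ?X = "(2 * int (card A) + 2) ^ length w"
  have bound: "\<bar>weight w a\<bar> \<le> ?X - 1" for a
    using Cons.IH[of a] Cons.prems by simp
  have X: "1 \<le> ?X" by simp
  have "\<bar>\<Sum>d\<in>dependent b. weight w d\<bar> \<le> (\<Sum>d\<in>dependent b. ?X - 1)"
    by (intro order.trans[OF sum_abs] sum_mono bound)
  also have "\<dots> \<le> (\<Sum>d\<in>A. ?X - 1)"
    using X by (intro sum_mono2 finite_A) (auto simp: dependent_def)
  finally have S: "\<bar>\<Sum>d\<in>dependent b. weight w d\<bar> \<le> ?k * (?X - 1)" by simp
  have "\<bar>weight (b # w) a\<bar> \<le> 1 + (?X - 1) + 2 * (?k * (?X - 1))"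
    using bound[of a] bound[of b] S X by (auto simp: reflect_eq)
  also have "\<dots> = (2 * ?k + 2) * ?X - (?X + 2 * ?k)"
    by (simp add: algebra_simps)
  also have "\<dots> < (2 * ?k + 2) * ?X"
    using X by linarith
  finally show ?case by simp
qed simp

end


section \<open>Nonzero integers modulo small numbers\<close>

text \<open>
  The numbers \<open>1 / ((n + 1) * (n choose k))\<close> form the Leibniz harmonic triangle, in which every
  entry is a difference of two entries with smaller \<open>k\<close>.
\<close>

lemma Suc_times_binomial_dvd:
  fixes x :: nat
  assumes "\<And>m. 0 < m \<Longrightarrow> m \<le> N \<Longrightarrow> m dvd x" and "n < N" and "k \<le> n"
  shows "Suc n * (n choose k) dvd x"
  using assms(2,3)
proof (induction k arbitrary: n)
  case 0
  then show ?case using assms(1) by simp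
next
  case (Suc k)
  obtain n' where n: "n = Suc n'" using Suc.prems by (cases n) auto
  have kn: "k \<le> n'" using Suc.prems n by simp
  have "Suc n' * (n' choose k) dvd x" "Suc n * (n choose k) dvd x"
    using Suc.IH[of n'] Suc.IH[of n] Suc.prems n by (simp_all del: mult_Suc)
  \<comment> \<open>\<open>p\<close> and \<open>q\<close> are \<open>x\<close> times the two
    triangle entries whose difference is the entry for \<open>Suc k\<close>; the cofactor sought is
    \<open>p - q\<close>.\<close>
  then obtain p q where p: "x = Suc n' * (n' choose k) * p" and q: "x = Suc n * (n choose k) * q"
    by (meson dvdE)
  let ?c = "real (n' choose k)"
  have c: "?c > 0" using kn by simp
  have "real (Suc n' * (n' choose k)) = real ((Suc n' choose Suc k) * Suc k)"
    by (simp only: Suc_times_binomial_eq)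
  then have up: "real (n choose Suc k) * (k + 1) = (n' + 1) * ?c"
    by (simp add: n algebra_simps del: binomial_Suc_Suc)
  have "real ((Suc n' - k) * (Suc n' choose k)) = real (Suc n' * (n' choose k))"
    by (subst binomial_absorb_comp) simp
  moreover have "real (Suc n' - k) = real n' + 1 - k" using kn by simp
  ultimately have diag: "(real n' + 1 - k) * real (n choose k) = (n' + 1) * ?c"
    unfolding n of_nat_mult by simp
  have rp: "real x = (n' + 1) * ?c * p" by (simp add: p algebra_simps)
  have rq: "real x = (n' + 2) * real (n choose k) * q"
    unfolding q by (simp add: n algebra_simps del: binomial_Suc_Suc)
  have "(real n' + 1 - k) * real x = (n' + 2) * ((real n' + 1 - k) * real (n choose k)) * q"
    by (subst rq) simp
  then have "(real n' + 1 - k) * ((n' + 1) * ?c * p) = (n' + 2) * ((n' + 1) * ?c) * q"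
    by (simp only: diag rp)
  then have "((n' + 1) * ?c) * ((real n' + 1 - k) * p) = ((n' + 1) * ?c) * ((n' + 2) * q)"
    by (simp only: of_nat_mult mult_ac)
  then have pq: "(real n' + 1 - k) * p = (n' + 2) * q"
    using c by (simp only: mult_cancel_left) auto
  have kp: "real (k + 1) * p = real (n' + 2) * (real p - real q)"
    using pq by (simp add: algebra_simps)
  have "(k + 1) * real x = (n' + 1) * ?c * (real (k + 1) * p)"
    unfolding rp by simp
  also have "\<dots> = (n' + 2) * (real (n choose Suc k) * (k + 1)) * (real p - real q)"
    unfolding up kp by simp
  finally have "(k + 1) * real x = (n' + 2) * (real (n choose Suc k) * (k + 1)) * (real p - real q)" .
  then have "(k + 1) * real x = (k + 1) * ((n' + 2) * real (n choose Suc k) * (real p - real q))"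
    by (simp add: mult_ac)
  then have "real x = (n' + 2) * real (n choose Suc k) * (real p - real q)"
    by (simp only: mult_cancel_left) auto
  then have "int x = int (Suc n * (n choose Suc k)) * (int p - int q)"
    unfolding n by (simp only: of_int_eq_iff[where ?'a = real, symmetric]) (simp del: binomial_Suc_Suc add: algebra_simps)
  then show ?case
    by (metis dvd_triv_left int_dvd_int_iff)
qed

text \<open>By the row sum, \<open>4 ^ n\<close> is at most \<open>2 * n + 1\<close> times the
  central binomial coefficient, and this product divides \<open>x\<close>.\<close>

lemma four_power_le_if_all_dvd:
  fixes x :: nat
  assumes "\<And>m. 0 < m \<Longrightarrow> m \<le> 2 * n + 1 \<Longrightarrow> m dvd x" and "0 < x"
  shows "4 ^ n \<le> x"
proof -
  have "4 ^ n = (2::nat) ^ (2 * n)" by (simp add: power_mult)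
  also have "\<dots> = (\<Sum>k\<le>2 * n. 2 * n choose k)"
    by (rule choose_row_sum[symmetric])
  also have "\<dots> \<le> (\<Sum>k\<le>2 * n. 2 * n choose n)"
    by (intro sum_mono binomial_maximum')
  also have "\<dots> = Suc (2 * n) * (2 * n choose n)" by simp
  also have "\<dots> \<le> x"
    using Suc_times_binomial_dvd[of "2 * n + 1" x "2 * n" n] assms by (intro dvd_imp_le) auto
  finally show ?thesis .
qed

lemma nonzero_mod_witness:
  fixes x :: int
  assumes "\<bar>x\<bar> < 2 ^ (2 ^ L - 2)" and "x \<noteq> 0" and "0 < L"
  shows "\<exists>m. 0 < m \<and> m < 2 ^ L \<and> x mod m \<noteq> 0"
proof (rule ccontr)
  assume no: "\<not> ?thesis"
  \<comment> \<open>With this \<open>n\<close>, the positive numbers up to \<open>2 * n + 1\<close>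
    are exactly those below \<open>2 ^ L\<close>, and \<open>4 ^ n\<close> is
    \<open>2 ^ (2 ^ L - 2)\<close>.\<close>
  define n where "n = (2::nat) ^ (L - 1) - 1"
  obtain l where l: "L = Suc l" using assms(3) by (cases L) auto
  have n: "2 * n + 1 = 2 ^ L - 1" "2 * n = 2 ^ L - 2"
    using one_le_power[of "2::nat" l] unfolding n_def l power_Suc diff_Suc_1
    by linarith+
  have "m dvd nat \<bar>x\<bar>" if "0 < m" "m \<le> 2 * n + 1" for m
  proof -
    have "m < 2 ^ L" using that n by (simp add: Suc_le_eq)
    then have "int m < 2 ^ L" by (metis of_nat_less_iff of_nat_numeral of_nat_power)
    then have "x mod int m = 0" using no that(1) by auto
    then show ?thesis by (simp add: mod_eq_0_iff_dvd)
  qed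
  then have "4 ^ n \<le> nat \<bar>x\<bar>"
    using assms(2) by (intro four_power_le_if_all_dvd) auto
  moreover have "(4::nat) ^ n = 2 ^ (2 ^ L - 2)"
    by (simp flip: n(2) add: power_mult)
  ultimately have "2 ^ (2 ^ L - 2) \<le> \<bar>x\<bar>"
    by (simp add: nat_le_iff le_nat_iff)
  with assms(1) show False by simp
qed


section \<open>Turing machines with arbitrary states and symbols\<close>

lemma input_cell_in_input_cells: "w \<in> lists A \<Longrightarrow> input_cell w p \<in> input_cells A"
  by (auto simp: input_cell_def input_cells_def in_lists_conv_set)

definition map_config :: "('q \<Rightarrow> 'r) \<Rightarrow> ('s \<Rightarrow> 't) \<Rightarrow> ('q, 's, 'o) config \<Rightarrow> ('r, 't, 'o) config" where
  "map_config f g c =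
    \<lparr>state = f (state c), input_pos = input_pos c, work_tape = g \<circ> work_tape c,
     work_pos = work_pos c, output_tape = output_tape c\<rparr>"

lemma map_config_simps [simp]:
  "state (map_config f g c) = f (state c)"
  "input_pos (map_config f g c) = input_pos c"
  "work_tape (map_config f g c) = g \<circ> work_tape c"
  "work_pos (map_config f g c) = work_pos c"
  "output_tape (map_config f g c) = output_tape c"
  by (simp_all add: map_config_def)

lemma logspace_computable_if_transducer:
  fixes M :: "('q, 's, 'i, 'o) transducer"
  assumes M: "transducer A B M" and F: "computes M A F" and S: "works_in_space M A S"
    and O: "(\<lambda>n. real (S n)) \<in> O(\<lambda>n. ln (real n))"
  shows "logspace_computable A B F"
proof -
  obtain f :: "'q \<Rightarrow> nat" where f: "inj_on f (states M)"
    using M finite_imp_inj_to_nat_seg[of "states M"] by (auto simp: transducer_def)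
  obtain g :: "'s \<Rightarrow> nat" where g: "inj_on g (work_symbols M)"
    using M finite_imp_inj_to_nat_seg[of "work_symbols M"] by (auto simp: transducer_def)
  define N :: "(nat, nat, 'i, 'o) transducer" where
    "N = \<lparr>states = f ` states M, work_symbols = g ` work_symbols M, start = f (start M),
      halting = f ` halting M, blank = g (blank M),
      transition = (\<lambda>q c s. case transition M (inv_into (states M) f q) c
          (inv_into (work_symbols M) g s) of (q', s', d, e, out) \<Rightarrow> (f q', g s', d, e, out))\<rparr>"
  \<comment> \<open>\<open>f\<close> and \<open>g\<close> are injective only on the states and
    symbols of \<open>M\<close>, so decoding requires that configurations stay inside these
    sets.\<close>
  define valid :: "('q, 's, 'o) config \<Rightarrow> bool" where
    "valid c \<longleftrightarrow> state c \<in> states M \<and> range (work_tape c) \<subseteq> work_symbols M" for c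
  have halting: "f q \<in> halting N \<longleftrightarrow> q \<in> halting M" if "q \<in> states M" for q
    using that f M by (auto simp: N_def transducer_def inj_on_image_mem_iff)
  have step: "valid (step M w c) \<and> step N w (map_config f g c) = map_config f g (step M w c)"
    if "w \<in> lists A" "valid c" for w c
  proof (cases "state c \<in> halting M")
    case True
    then show ?thesis using that halting by (simp add: step_def valid_def)
  next
    case False
    obtain q s d e out where t:
      "transition M (state c) (input_cell w (input_pos c)) (work_tape c (work_pos c)) =
        (q, s, d, e, out)"
      using prod_cases5 by blast
    have c: "state c \<in> states M" "work_tape c (work_pos c) \<in> work_symbols M"
      using that by (auto simp: valid_def)
    have "q \<in> states M" "s \<in> work_symbols M"
      using M c input_cell_in_input_cells[OF that(1), of "input_pos c"] t
      unfolding transducer_def by fastforce+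
    moreover have "f (state c) \<notin> halting N"
      using halting[OF c(1)] False by simp
    moreover have "transition N (f (state c)) (input_cell w (input_pos c))
        (g (work_tape c (work_pos c))) = (f q, g s, d, e, out)"
      by (simp add: N_def f g c t)
    ultimately show ?thesis
      using that False t by (auto simp: step_def valid_def map_config_def fun_upd_def)
  qed
  have run: "valid (run M w k) \<and> run N w k = map_config f g (run M w k)" if "w \<in> lists A" for w k
  proof (induction k)
    case 0
    then show ?case
      using M
      by (auto simp: run_def valid_def initial_config_def map_config_def N_def transducer_def)
  next
    case (Suc k)
    then show ?case using step[OF that] by (simp add: run_def)
  qed
  have "transducer A B N"
    unfolding transducer_def
  proof (intro conjI ballI)
    fix q c s
    assume "q \<in> states N" "c \<in> input_cells A" "s \<in> work_symbols N"
    then obtain q' s' where "q' \<in> states M" "q = f q'" "s' \<in> work_symbols M" "s = g s'"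
      by (auto simp: N_def)
    moreover obtain q'' s'' d e out where "transition M q' c s' = (q'', s'', d, e, out)"
      using prod_cases5 by blast
    moreover from calculation have "q'' \<in> states M" "s'' \<in> work_symbols M" "set_option out \<subseteq> B"
      using M \<open>c \<in> input_cells A\<close> unfolding transducer_def by fastforce+
    ultimately show "case transition N q c s of (q', s', d, e, out) \<Rightarrow>
        q' \<in> states N \<and> s' \<in> work_symbols N \<and> set_option out \<subseteq> B"
      by (simp add: N_def f g)
  qed (use M in \<open>auto simp: N_def transducer_def\<close>)
  moreover have "computes N A F"
    unfolding computes_def
  proof
    fix w assume w: "w \<in> lists A"
    then obtain k where "state (run M w k) \<in> halting M" "output_tape (run M w k) = F w"
      using F by (auto simp: computes_def)
    then show "\<exists>k. state (run N w k) \<in> halting N \<and> output_tape (run N w k) = F w"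
      using run[OF w, of k] halting by (intro exI[of _ k]) (simp add: valid_def)
  qed
  moreover have "works_in_space N A S"
    using S run by (simp add: works_in_space_def)
  ultimately show ?thesis
    using O unfolding logspace_computable_def by blast
qed

text \<open>With the head bound inside the relation, its closure certifies reachability and space at
  once. Only the source is constrained, so the last configuration is checked separately.\<close>

definition confined_step ::
    "('q, 's, 'i, 'o) transducer \<Rightarrow> 'i list \<Rightarrow> nat \<Rightarrow> ('q, 's, 'o) config \<Rightarrow>
      ('q, 's, 'o) config \<Rightarrow> bool" where
  "confined_step M w S c c' \<longleftrightarrow> work_pos c < S \<and> c' = step M w c"

lemma confined_steps_halting:
  assumes "(confined_step M w S)\<^sup>*\<^sup>* c c'" and "state c' \<in> halting M" and "work_pos c' < S"
  shows "\<exists>k. (step M w ^^ k) c = c'" and "work_pos ((step M w ^^ k) c) < S"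
proof -
  have "(\<exists>k. (step M w ^^ k) c = c') \<and> (\<forall>k. work_pos ((step M w ^^ k) c) < S)"
    using assms(1)
  proof (induction rule: converse_rtranclp_induct)
    case base
    \<comment> \<open>A halting configuration is a fixed point of \<open>step\<close>, so the bound
      extends to all later times.\<close>
    have "(step M w ^^ k) c' = c'" for k
      by (induction k) (simp_all add: step_def assms(2))
    then show ?case using assms(3) by simp
  next
    case (step c d)
    have "work_pos ((step M w ^^ k) c) < S" for k
      using step by (cases k)
        (simp_all add: confined_step_def funpow_swap1 del: funpow.simps(2), simp add: funpow_swap1)
    moreover have "(step M w ^^ Suc k) c = (step M w ^^ k) d" for k
      using step by (simp add: confined_step_def funpow_swap1)
    ultimately show ?case using step.IH by metis
  qed
  then show "\<exists>k. (step M w ^^ k) c = c'" and "work_pos ((step M w ^^ k) c) < S" by auto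
qed


section \<open>Machines that sweep over binary registers\<close>

text \<open>
  Registers \<open>x v < 2 ^ L\<close> for \<open>v \<in> V\<close> are stored in the cells \<open>1, \<dots>, L\<close> of the work tape, least
  significant bits first, where one cell contains a bit of every register.  In a sweep from left
  to right the machine computes an affine combination of the registers, keeping only the carry in
  its state.  The result modulo \<open>2 ^ L\<close> is written to the target registers, and the final carry
  determines the next state, the move of the input head, whether \<open>L\<close> is increased, and the output.
\<close>

datatype 'v symbol = Start_Mark | Bits "'v set" | Blank

datatype 'q control = Begin 'q | Sweep 'q int | Return 'q

text \<open>State, position of the input head, \<open>L\<close>, registers, and output.\<close>

type_synonym ('q, 'v, 'o) sweep_config = "'q \<times> nat \<times> nat \<times> ('v \<Rightarrow> int) \<times> 'o list"

locale sweep_program =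
  fixes A :: "'i set" and B :: "'o set" and V :: "'v set" and Q :: "'q set"
    and q0 :: 'q and H :: "'q set"
    and const :: "'q \<Rightarrow> 'i cell \<Rightarrow> int"
    and coeff :: "'q \<Rightarrow> 'i cell \<Rightarrow> 'v \<Rightarrow> int"
    and target :: "'q \<Rightarrow> 'i cell \<Rightarrow> 'v set"
    and next_action :: "'q \<Rightarrow> 'i cell \<Rightarrow> int \<Rightarrow> 'q \<times> move \<times> bool \<times> 'o option"
  assumes finite: "finite A" "finite B" "finite V" "finite Q"
    and states_subset: "q0 \<in> Q" "H \<subseteq> Q"
    and closed: "\<lbrakk>q \<in> Q; c \<in> input_cells A; next_action q c r = (q', d, e, out)\<rbrakk> \<Longrightarrow>
      q' \<in> Q \<and> set_option out \<subseteq> B"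
begin

section \<open>Sweep programs and their Turing machines\<close>

definition result :: "'q \<Rightarrow> 'i cell \<Rightarrow> ('v \<Rightarrow> int) \<Rightarrow> int" where
  "result q c x = const q c + (\<Sum>v\<in>V. coeff q c v * x v)"

definition update :: "'q \<Rightarrow> 'i cell \<Rightarrow> nat \<Rightarrow> ('v \<Rightarrow> int) \<Rightarrow> 'v \<Rightarrow> int" where
  "update q c L x = (\<lambda>v. if v \<in> target q c then result q c x mod 2 ^ L else x v)"

text \<open>The control learns about the registers only through
  \<open>result q c x div 2 ^ L\<close>, which is 0 if the result fits into \<open>L\<close> bits,
  negative if the result is negative, and positive on overflow.\<close>

inductive sweep_step ::
    "'i list \<Rightarrow> ('q, 'v, 'o) sweep_config \<Rightarrow> ('q, 'v, 'o) sweep_config \<Rightarrow> bool"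
  for w where
  "\<lbrakk>q \<notin> H; c = input_cell w p; next_action q c (result q c x div 2 ^ L) = (q', d, e, out')\<rbrakk> \<Longrightarrow>
    sweep_step w (q, p, L, x, out)
      (q', min (length w + 1) (move_head d p), if e then Suc L else L, update q c L x,
       out @ (case out' of None \<Rightarrow> [] | Some b \<Rightarrow> [b]))"

text \<open>A carry \<open>r\<close> becomes \<open>(r + s) div 2\<close> with \<open>s\<close> a
  partial sum of coefficients. A common bound for the constants and all such \<open>s\<close> thus
  bounds every carry and keeps the state set finite.\<close>

definition carry_bound :: int where
  "carry_bound =
    (\<Sum>q\<in>Q. \<Sum>c\<in>input_cells A. \<bar>const q c\<bar> + (\<Sum>v\<in>V. \<bar>coeff q c v\<bar>))"

text \<open>The mark written by \<open>Begin\<close> lets \<open>Return\<close> recognise cell 0. A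
  blank cell ends the registers; turning it into \<open>Bits {}\<close> gives each of them a new top
  bit 0.\<close>

fun delta :: "'q control \<Rightarrow> 'i cell \<Rightarrow> 'v symbol \<Rightarrow> 'q control \<times> 'v symbol \<times> move \<times> move \<times> 'o option"
  where
  "delta (Begin q) c s = (Sweep q (const q c), Start_Mark, Stay, Move_Right, None)"
| "delta (Sweep q r) c (Bits X) =
    (let t = r + (\<Sum>v\<in>V \<inter> X. coeff q c v)
     in (Sweep q (t div 2), Bits {v \<in> V. if v \<in> target q c then odd t else v \<in> X},
         Stay, Move_Right, None))"
| "delta (Sweep q r) c Blank =
    (case next_action q c r of (q', d, e, out) \<Rightarrow>
      (Return q', if e then Bits {} else Blank, d, Move_Left, out))"
| "delta (Sweep q r) c Start_Mark = (Sweep q r, Start_Mark, Stay, Stay, None)"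
| "delta (Return q) c Start_Mark = (Begin q, Start_Mark, Stay, Stay, None)"
| "delta (Return q) c s = (Return q, s, Stay, Move_Left, None)"

definition machine :: "('q control, 'v symbol, 'i, 'o) transducer" where
  "machine =
    \<lparr>states = Begin ` Q \<union> Return ` Q \<union> (\<lambda>(q, r). Sweep q r) ` (Q \<times> {- carry_bound..carry_bound}),
     work_symbols = {Start_Mark, Blank} \<union> Bits ` Pow V,
     start = Begin q0, halting = Begin ` H, blank = Blank, transition = delta\<rparr>"

lemma finite_input_cells: "finite (input_cells A)"
  using finite by (simp add: input_cells_def)

lemma carry_bound:
  assumes "q \<in> Q" and "c \<in> input_cells A"
  shows "\<bar>const q c\<bar> + (\<Sum>v\<in>V. \<bar>coeff q c v\<bar>) \<le> carry_bound"
proof -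
  have "\<bar>const q c\<bar> + (\<Sum>v\<in>V. \<bar>coeff q c v\<bar>) \<le>
      (\<Sum>c\<in>input_cells A. \<bar>const q c\<bar> + (\<Sum>v\<in>V. \<bar>coeff q c v\<bar>))"
    by (rule member_le_sum[OF assms(2), where f = "\<lambda>c. \<bar>const q c\<bar> + (\<Sum>v\<in>V. \<bar>coeff q c v\<bar>)"])
      (auto simp: finite_input_cells intro!: add_nonneg_nonneg sum_nonneg)
  also have "\<dots> \<le> carry_bound"
    unfolding carry_bound_def
    by (rule member_le_sum[OF assms(1), where
          f = "\<lambda>q. \<Sum>c\<in>input_cells A. \<bar>const q c\<bar> + (\<Sum>v\<in>V. \<bar>coeff q c v\<bar>)"])
      (auto simp: finite intro!: add_nonneg_nonneg sum_nonneg)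
  finally show ?thesis .
qed

lemma states_machine:
  "Begin q \<in> states machine \<longleftrightarrow> q \<in> Q" "Return q \<in> states machine \<longleftrightarrow> q \<in> Q"
  "Sweep q r \<in> states machine \<longleftrightarrow> q \<in> Q \<and> \<bar>r\<bar> \<le> carry_bound"
  by (auto simp: machine_def image_iff abs_le_iff)

lemma work_symbols_machine:
  "Start_Mark \<in> work_symbols machine" "Blank \<in> work_symbols machine"
  "Bits X \<in> work_symbols machine \<longleftrightarrow> X \<subseteq> V"
  by (auto simp: machine_def)

lemma transducer_machine: "transducer A B machine"
proof -
  have "case delta k c s of (k', s', d, e, out) \<Rightarrow>
      k' \<in> states machine \<and> s' \<in> work_symbols machine \<and> set_option out \<subseteq> B"
    if k: "k \<in> states machine" and c: "c \<in> input_cells A" and s: "s \<in> work_symbols machine"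
    for k c s
  proof (cases k)
    case (Begin q)
    then have "q \<in> Q" using k by (auto simp: states_machine work_symbols_machine)
    moreover have "0 \<le> (\<Sum>v\<in>V. \<bar>coeff q c v\<bar>)" by (simp add: sum_nonneg)
    ultimately have "\<bar>const q c\<bar> \<le> carry_bound"
      using carry_bound[of q c, OF _ c] by linarith
    then show ?thesis using Begin k by (auto simp: states_machine work_symbols_machine)
  next
    case (Return q)
    then show ?thesis using k s by (cases s) (auto simp: states_machine work_symbols_machine)
  next
    case (Sweep q r)
    then have q: "q \<in> Q" and r: "\<bar>r\<bar> \<le> carry_bound"
      using k by (auto simp: states_machine work_symbols_machine)
    show ?thesis
    proof (cases s)
      case (Bits X)
      have "\<bar>\<Sum>v\<in>V \<inter> X. coeff q c v\<bar> \<le> (\<Sum>v\<in>V \<inter> X. \<bar>coeff q c v\<bar>)"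
        by (rule sum_abs)
      also have "\<dots> \<le> (\<Sum>v\<in>V. \<bar>coeff q c v\<bar>)"
        by (intro sum_mono2 finite) auto
      also have "\<dots> \<le> carry_bound"
        using carry_bound[OF q c] by linarith
      finally have "\<bar>(r + (\<Sum>v\<in>V \<inter> X. coeff q c v)) div 2\<bar> \<le> carry_bound"
        using r by linarith
      then show ?thesis
        using q Sweep Bits by (auto simp: states_machine work_symbols_machine Let_def)
    next
      case Blank
      obtain q' d e out where n: "next_action q c r = (q', d, e, out)"
        using prod_cases4 by blast
      then show ?thesis
        using closed[OF q c n] Sweep Blank by (auto simp: states_machine work_symbols_machine)
    next
      case Start_Mark
      then show ?thesis using k Sweep by (auto simp: states_machine work_symbols_machine)
    qed
  qed
  then show ?thesis
    using finite states_subset unfolding transducer_def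
    by (auto simp: machine_def)
qed

section \<open>Bitwise computation of affine combinations\<close>

definition bits :: "('v \<Rightarrow> int) \<Rightarrow> nat \<Rightarrow> 'v symbol" where
  "bits x i = Bits {v \<in> V. bit (x v) i}"

text \<open>The tape during a sweep: the first \<open>i\<close> bits of the registers have been changed to \<open>y\<close>.\<close>

definition tape :: "nat \<Rightarrow> ('v \<Rightarrow> int) \<Rightarrow> ('v \<Rightarrow> int) \<Rightarrow> nat \<Rightarrow> nat \<Rightarrow> 'v symbol" where
  "tape L x y i j =
    (if j = 0 then Start_Mark else if j \<le> i then bits y (j - 1)
     else if j \<le> L then bits x (j - 1) else Blank)"

definition carry :: "'q \<Rightarrow> 'i cell \<Rightarrow> ('v \<Rightarrow> int) \<Rightarrow> nat \<Rightarrow> int" where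
  "carry q c x i = (const q c + (\<Sum>v\<in>V. coeff q c v * (x v mod 2 ^ i))) div 2 ^ i"

text \<open>This is schoolbook addition with column total \<open>t i\<close>. Splitting off bit
  \<open>i\<close> of every \<open>x v\<close> gives the next carry; for the parity, the higher bits
  contribute an even amount to \<open>result q c x div 2 ^ i\<close>.\<close>

lemma
  fixes x :: "'v \<Rightarrow> int" and q :: 'q and c :: "'i cell"
  defines "t i \<equiv> carry q c x i + (\<Sum>v | v \<in> V \<and> bit (x v) i. coeff q c v)"
  shows carry_Suc: "carry q c x (Suc i) = t i div 2"
    and bit_result: "bit (result q c x) i \<longleftrightarrow> odd (t i)"
proof -
  have "(\<Sum>v | v \<in> V \<and> bit (x v) i. coeff q c v) = (\<Sum>v\<in>V. if bit (x v) i then coeff q c v else 0)"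
    by (rule sum.inter_filter[OF finite(3)])
  also have "\<dots> = (\<Sum>v\<in>V. coeff q c v * (x v div 2 ^ i mod 2))"
    by (intro sum.cong) (auto simp: bit_iff_odd odd_iff_mod_2_eq_one)
  finally have t: "t i = carry q c x i + (\<Sum>v\<in>V. coeff q c v * (x v div 2 ^ i mod 2))"
    by (simp add: t_def)
  have "const q c + (\<Sum>v\<in>V. coeff q c v * (x v mod 2 ^ Suc i)) =
      const q c + (\<Sum>v\<in>V. coeff q c v * (x v mod 2 ^ i)) +
      2 ^ i * (\<Sum>v\<in>V. coeff q c v * (x v div 2 ^ i mod 2))"
    unfolding power_Suc2 zmod_zmult2_eq[OF zero_le_numeral]
    by (simp add: zmod_zmult2_eq sum_distrib_left sum.distrib algebra_simps)
  moreover have "(a + 2 ^ i * b) div 2 ^ Suc i = (a div 2 ^ i + b) div 2" for a b :: int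
    unfolding power_Suc2 by (subst zdiv_zmult2_eq) (simp_all add: add.commute)
  ultimately show "carry q c x (Suc i) = t i div 2"
    by (simp only: t carry_def)
  have x: "x v = x v mod 2 ^ i + 2 ^ i * (x v div 2 ^ i)" for v by simp
  have "result q c x = const q c + (\<Sum>v\<in>V. coeff q c v * (x v mod 2 ^ i)) +
      2 ^ i * (\<Sum>v\<in>V. coeff q c v * (x v div 2 ^ i))"
    unfolding result_def
    by (subst x) (simp only: sum_distrib_left sum.distrib algebra_simps)
  then have "result q c x div 2 ^ i = carry q c x i + (\<Sum>v\<in>V. coeff q c v * (x v div 2 ^ i))"
    by (simp add: carry_def)
  moreover have "even ((\<Sum>v\<in>V. coeff q c v * (x v div 2 ^ i)) -
      (\<Sum>v\<in>V. coeff q c v * (x v div 2 ^ i mod 2)))"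
    by (simp only: sum_subtractf[symmetric] right_diff_distrib[symmetric])
      (intro dvd_sum dvd_mult, simp add: minus_mod_eq_mult_div)
  ultimately show "bit (result q c x) i \<longleftrightarrow> odd (t i)"
    unfolding t by (simp add: bit_iff_odd)
qed

lemma carry_0: "carry q c x 0 = const q c"
  by (simp add: carry_def)

lemma carry_width:
  assumes "\<And>v. v \<in> V \<Longrightarrow> 0 \<le> x v \<and> x v < 2 ^ L"
  shows "carry q c x L = result q c x div 2 ^ L"
  using assms by (simp add: carry_def result_def)

section \<open>Simulation of sweep programs\<close>

lemma step_machine:
  assumes "state s = k" and "k \<notin> Begin ` H"
    and "delta k (input_cell w (input_pos s)) (work_tape s (work_pos s)) = (k', a, d, e, out)"
  shows "step machine w s =
    \<lparr>state = k', input_pos = min (length w + 1) (move_head d (input_pos s)),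
     work_tape = (work_tape s)(work_pos s := a), work_pos = move_head e (work_pos s),
     output_tape = output_tape s @ (case out of None \<Rightarrow> [] | Some b \<Rightarrow> [b])\<rparr>"
  using assms by (simp add: step_def machine_def)

lemma confined_step_machine:
  assumes "k \<notin> Begin ` H" and "delta k (input_cell w p) (t j) = (k', a, d, e, out)" and "j < S"
    and "t(j := a) = t'" and "move_head e j = j'"
  shows "confined_step machine w S
    \<lparr>state = k, input_pos = p, work_tape = t, work_pos = j, output_tape = os\<rparr>
    \<lparr>state = k', input_pos = min (length w + 1) (move_head d p), work_tape = t', work_pos = j',
     output_tape = os @ (case out of None \<Rightarrow> [] | Some b \<Rightarrow> [b])\<rparr>"
  using assms by (simp add: confined_step_def step_machine)

lemma sweep_bits:
  assumes "i \<le> L" and "Suc L < S" and p: "p \<le> length w + 1" and c: "c = input_cell w p"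
  shows "(confined_step machine w S)\<^sup>*\<^sup>*
    \<lparr>state = Sweep q (const q c), input_pos = p, work_tape = tape L x y 0, work_pos = 1,
     output_tape = out\<rparr>
    \<lparr>state = Sweep q (carry q c x i), input_pos = p, work_tape = tape L x (update q c L x) i,
     work_pos = Suc i, output_tape = out\<rparr>"
  using assms(1)
proof (induction i)
  case 0
  have "tape L x y 0 = tape L x (update q c L x) 0"
    by (auto simp: tape_def fun_eq_iff)
  then show ?case by (simp add: carry_0)
next
  case (Suc i)
  let ?y = "update q c L x"
  let ?X = "{v \<in> V. bit (x v) i}"
  let ?s = "\<lparr>state = Sweep q (carry q c x i), input_pos = p, work_tape = tape L x ?y i,
     work_pos = Suc i, output_tape = out\<rparr>"
  have "(tape L x ?y i)(Suc i := bits ?y i) = tape L x ?y (Suc i)"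
    by (auto simp: tape_def fun_eq_iff le_Suc_eq)
  \<comment> \<open>As \<open>i < L\<close>, reducing the result modulo \<open>2 ^ L\<close> does
    not change its bit \<open>i\<close>.\<close>
  moreover have "bit (?y v) i \<longleftrightarrow>
      odd (carry q c x i + (\<Sum>v | v \<in> V \<and> bit (x v) i. coeff q c v))" if "v \<in> target q c" for v
    using that Suc.prems unfolding bit_result[symmetric]
    by (simp add: update_def bit_take_bit_iff flip: take_bit_eq_mod)
  then have "{v \<in> V. if v \<in> target q c
      then odd (carry q c x i + (\<Sum>v | v \<in> V \<and> bit (x v) i. coeff q c v)) else v \<in> ?X} =
      {v \<in> V. bit (?y v) i}"
    by (auto simp: update_def)
  moreover have "tape L x ?y i (Suc i) = Bits ?X"
    using Suc.prems by (simp add: tape_def bits_def)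
  moreover have "V \<inter> ?X = ?X" by blast
  ultimately have "step machine w ?s =
    \<lparr>state = Sweep q (carry q c x (Suc i)), input_pos = p, work_tape = tape L x ?y (Suc i),
     work_pos = Suc (Suc i), output_tape = out\<rparr>"
    using p by (subst step_machine[OF HOL.refl])
      (auto simp: Let_def carry_Suc bits_def simp flip: c)
  moreover have "work_pos ?s < S" using Suc.prems assms(2) by simp
  ultimately show ?case
    using Suc by (intro rtranclp.rtrancl_into_rtrancl[OF Suc.IH]) (auto simp: confined_step_def)
qed

lemma return_to_start:
  assumes "j \<le> L" and "L < S" and p: "p \<le> length w + 1"
  shows "(confined_step machine w S)\<^sup>*\<^sup>*
    \<lparr>state = Return q, input_pos = p, work_tape = tape L x x 0, work_pos = j, output_tape = out\<rparr>
    \<lparr>state = Begin q, input_pos = p, work_tape = tape L x x 0, work_pos = 0, output_tape = out\<rparr>"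
  using assms(1)
proof (induction j)
  case 0
  let ?s = "\<lparr>state = Return q, input_pos = p, work_tape = tape L x x 0, work_pos = 0,
    output_tape = out\<rparr>"
  have t: "tape L x x 0 0 = Start_Mark" by (simp add: tape_def)
  then have "(tape L x x 0)(0 := Start_Mark) = tape L x x 0" by auto
  then have "step machine w ?s = \<lparr>state = Begin q, input_pos = p, work_tape = tape L x x 0,
      work_pos = 0, output_tape = out\<rparr>"
    using t p by (subst step_machine[OF HOL.refl]) auto
  then show ?case using assms by (intro r_into_rtranclp) (simp add: confined_step_def)
next
  case (Suc j)
  let ?s = "\<lparr>state = Return q, input_pos = p, work_tape = tape L x x 0, work_pos = Suc j,
    output_tape = out\<rparr>"
  have t: "tape L x x 0 (Suc j) = bits x j" using Suc.prems by (simp add: tape_def)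
  then have "(tape L x x 0)(Suc j := bits x j) = tape L x x 0" by auto
  then have "step machine w ?s = \<lparr>state = Return q, input_pos = p, work_tape = tape L x x 0,
      work_pos = j, output_tape = out\<rparr>"
    using t p by (subst step_machine[OF HOL.refl]) (auto simp: bits_def)
  then show ?case using assms(2) Suc
    by (intro converse_rtranclp_into_rtranclp[OF _ Suc.IH]) (simp_all add: confined_step_def)
qed

text \<open>Cell 0 is exempted because it is still blank in the initial configuration;
  \<open>Begin\<close> writes the mark there.\<close>

fun encodes :: "'i list \<Rightarrow> ('q, 'v, 'o) sweep_config \<Rightarrow> ('q control, 'v symbol, 'o) config \<Rightarrow> bool"
  where
  "encodes w (q, p, L, x, out) s \<longleftrightarrow>
    q \<in> Q \<and> p \<le> length w + 1 \<and> (\<forall>v\<in>V. 0 \<le> x v \<and> x v < 2 ^ L) \<and>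
    state s = Begin q \<and> input_pos s = p \<and> (work_tape s)(0 := Start_Mark) = tape L x x 0 \<and>
    work_pos s = 0 \<and> output_tape s = out"

fun width :: "('q, 'v, 'o) sweep_config \<Rightarrow> nat" where
  "width (q, p, L, x, out) = L"

text \<open>The machine marks cell 0, sweeps over the registers, consults \<open>next_action\<close>
  at the first blank and walks back. The head gets as far as cell \<open>Suc L\<close>.\<close>

lemma simulate_step:
  assumes w: "w \<in> lists A" and step: "sweep_step w s s'" and s: "encodes w s k"
    and S: "Suc (width s') < S"
  shows "\<exists>k'. (confined_step machine w S)\<^sup>*\<^sup>* k k' \<and> encodes w s' k'"
  using step
proof cases
  case (1 q c p x L q' d e out' out)
  note n = 1(5)
  let ?y = "update q c L x"
  let ?L = "if e then Suc L else L"
  let ?p = "min (length w + 1) (move_head d p)"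
  let ?out = "out @ (case out' of None \<Rightarrow> [] | Some b \<Rightarrow> [b])"
  let ?k1 = "\<lparr>state = Sweep q (const q c), input_pos = p,
      work_tape = tape L x x 0, work_pos = 1, output_tape = out\<rparr>"
  let ?k2 = "\<lparr>state = Sweep q (carry q c x L), input_pos = p, work_tape = tape L x ?y L,
     work_pos = Suc L, output_tape = out\<rparr>"
  let ?k3 = "\<lparr>state = Return q', input_pos = ?p, work_tape = tape ?L ?y ?y 0, work_pos = L,
     output_tape = ?out\<rparr>"
  let ?k4 = "\<lparr>state = Begin q', input_pos = ?p, work_tape = tape ?L ?y ?y 0, work_pos = 0,
     output_tape = ?out\<rparr>"
  have x: "0 \<le> x v" "x v < 2 ^ L" if "v \<in> V" for v
    using s 1 that by auto
  have q: "q \<in> Q" and p: "p \<le> length w + 1" and k: "state k = Begin q" "input_pos k = p"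
    "(work_tape k)(0 := Start_Mark) = tape L x x 0" "work_pos k = 0" "output_tape k = out"
    using s 1 by auto
  have SL: "Suc L < S" using S 1 by (auto split: if_splits)
  have "Begin q \<notin> Begin ` H" using 1 by auto
  then have "step machine w k = ?k1"
    using k p 1 by (subst step_machine[OF k(1)]) auto
  then have k1: "confined_step machine w S k ?k1"
    using SL k by (simp add: confined_step_def)
  have k2: "(confined_step machine w S)\<^sup>*\<^sup>* ?k1 ?k2"
    by (rule sweep_bits[OF order.refl SL p 1(4)])
  have k3: "confined_step machine w S ?k2 ?k3"
  proof -
    have "tape L x ?y L (Suc L) = Blank" by (simp add: tape_def)
    moreover have "carry q c x L = result q c x div 2 ^ L"
      using x by (intro carry_width) auto
    moreover have "\<not> bit (?y v) L" if "v \<in> V" for v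
      using x[OF that] by (auto simp: update_def bit_iff_odd)
    then have "bits ?y L = Bits {}" by (auto simp: bits_def)
    then have "(tape L x ?y L)(Suc L := if e then Bits {} else Blank) = tape ?L ?y ?y 0"
      by (auto simp: tape_def fun_eq_iff le_Suc_eq)
    ultimately have d: "delta (Sweep q (carry q c x L)) (input_cell w p) (tape L x ?y L (Suc L)) =
        (Return q', if e then Bits {} else Blank, d, Move_Left, out')"
      and t: "(tape L x ?y L)(Suc L := if e then Bits {} else Blank) = tape ?L ?y ?y 0"
      using n 1(4) by simp_all
    show ?thesis
      by (rule confined_step_machine[OF _ d SL t]) auto
  qed
  have k4: "(confined_step machine w S)\<^sup>*\<^sup>* ?k3 ?k4"
    using S 1 by (intro return_to_start) auto
  have "(confined_step machine w S)\<^sup>*\<^sup>* k ?k4"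
    using rtranclp.rtrancl_into_rtrancl[where r = "confined_step machine w S", OF k2 k3] k1 k4
    by (meson converse_rtranclp_into_rtranclp rtranclp_trans)
  moreover have "encodes w s' ?k4"
  proof -
    have "q' \<in> Q" using closed[OF q _ n] 1(4) input_cell_in_input_cells[OF w] by simp
    moreover have "0 \<le> ?y v \<and> ?y v < 2 ^ ?L" if "v \<in> V" for v
    proof -
      have "0 \<le> ?y v" "?y v < 2 ^ L"
        using x[OF that] by (simp_all add: update_def)
      moreover have "(2::int) ^ L \<le> 2 ^ ?L" by simp
      ultimately show ?thesis by linarith
    qed
    moreover have "(tape ?L ?y ?y 0)(0 := Start_Mark) = tape ?L ?y ?y 0"
      by (auto simp: tape_def)
    ultimately show ?thesis using 1 by simp
  qed
  ultimately show ?thesis by blast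
qed

text \<open>Registers never get narrower, so a space bound for the final width serves the whole
  run.\<close>

lemma width_mono: "(sweep_step w)\<^sup>*\<^sup>* s s' \<Longrightarrow> width s \<le> width s'"
  by (induction rule: rtranclp_induct) (auto elim!: sweep_step.cases)

lemma simulate_steps:
  assumes w: "w \<in> lists A" and steps: "(sweep_step w)\<^sup>*\<^sup>* s s'" and s: "encodes w s k"
    and S: "Suc (width s') < S"
  shows "\<exists>k'. (confined_step machine w S)\<^sup>*\<^sup>* k k' \<and> encodes w s' k'"
  using steps s
proof (induction arbitrary: k rule: converse_rtranclp_induct)
  case base
  then show ?case by blast
next
  case (step s t)
  have "Suc (width t) < S" using width_mono[OF step(2)] S by simp
  then show ?case
    using simulate_step[OF w step(1,4)] step(3) by (meson rtranclp_trans)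
qed

theorem logspace_computable_if_sweep_program:
  assumes run: "\<And>w. w \<in> lists A \<Longrightarrow> \<exists>q p L x. q \<in> H \<and> Suc L < S (length w) \<and>
      (sweep_step w)\<^sup>*\<^sup>* (q0, 0, 0, \<lambda>_. 0, []) (q, p, L, x, F w)"
    and S: "(\<lambda>n. real (S n)) \<in> O(\<lambda>n. ln (real n))"
  shows "logspace_computable A B F"
proof -
  have *: "(\<exists>k. state (run machine w k) \<in> halting machine \<and> output_tape (run machine w k) = F w) \<and>
      (\<forall>k. work_pos (run machine w k) < S (length w))" if w: "w \<in> lists A" for w
  proof -
    obtain q p L x where q: "q \<in> H" "Suc L < S (length w)"
      and steps: "(sweep_step w)\<^sup>*\<^sup>* (q0, 0, 0, \<lambda>_. 0, []) (q, p, L, x, F w)"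
      using run[OF w] by blast
    have "encodes w (q0, 0, 0, \<lambda>_. 0, []) (initial_config machine)"
      using states_subset by (auto simp: initial_config_def machine_def tape_def fun_eq_iff)
    then obtain k where k: "(confined_step machine w (S (length w)))\<^sup>*\<^sup>* (initial_config machine) k"
      "encodes w (q, p, L, x, F w) k"
      using simulate_steps[OF w steps] q(2) by auto
    then have "state k \<in> halting machine" "work_pos k < S (length w)"
      using q by (auto simp: machine_def)
    note halts = confined_steps_halting[OF k(1) this]
    obtain n where "run machine w n = k" using halts(1) by (auto simp: run_def)
    then show ?thesis
      using \<open>state k \<in> halting machine\<close> k(2) halts(2)
      by (intro conjI exI[of _ n] allI) (simp_all add: run_def)
  qed
  show ?thesis
  proof (rule logspace_computable_if_transducer[OF transducer_machine _ _ S])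
    show "computes machine A F" using * by (simp add: computes_def)
    show "works_in_space machine A S" using * by (simp add: works_in_space_def)
  qed
qed

end


section \<open>The algorithm\<close>

text \<open>
  In the states \<open>Reduce i j\<close> and \<open>Write i j\<close>, \<open>i\<close> is an index into the list of letters and \<open>j\<close> is
  a candidate for the quotient in a division by the modulus.
\<close>

datatype phase = Count | Extend nat | Next_Modulus nat | Rewind nat | Reduce nat int
  | Write nat int | Output nat

locale enumerated_alphabet = alphabet A I for A :: "'a set" and I +
  fixes letters :: "'a list"
  assumes set_letters: "set letters = A"
begin

text \<open>From residues below \<open>m\<close>, a reflected coordinate lies above
  \<open>- m\<close> and is at most \<open>1 + 2 * card A * (m - 1)\<close>, so its quotient by
  \<open>m\<close> lies between -1 and this number.\<close>

definition max_quotient :: int where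
  "max_quotient = 2 * int (card A) + 1"

definition phases :: "phase set" where
  "phases = {Count} \<union> Extend ` {..card A} \<union> Next_Modulus ` {..length letters} \<union>
    Rewind ` {..<length letters} \<union> Output ` {..<length letters} \<union>
    (\<lambda>(i, j). Reduce i j) ` ({..<length letters} \<times> {-1..max_quotient}) \<union>
    (\<lambda>(i, j). Write i j) ` ({..<length letters} \<times> {-1..max_quotient})"

text \<open>The register \<open>None\<close> holds the modulus, the register \<open>Some a\<close> holds a residue of the weight.\<close>

definition registers :: "'a option set" where
  "registers = insert None (Some ` A)"

section \<open>The sweep program that computes the alphabet\<close>

fun const :: "phase \<Rightarrow> 'a cell \<Rightarrow> int" where
  "const Count c = 1"
| "const (Next_Modulus i) c = 1"
| "const (Reduce i j) (Letter a) = 1"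
| "const (Write i j) (Letter a) = 1"
| "const _ _ = 0"

text \<open>On a letter \<open>a\<close>, \<open>Reduce\<close> and \<open>Write\<close> evaluate
  the reflected coordinate of \<open>a\<close> minus \<open>j\<close> times the modulus. At the left
  end, \<open>Reduce\<close> evaluates minus the residue of letter \<open>i\<close>, so a negative
  carry signals a nonzero residue.\<close>

fun coeff :: "phase \<Rightarrow> 'a cell \<Rightarrow> 'a option \<Rightarrow> int" where
  "coeff Count c v = of_bool (v = None)"
| "coeff (Next_Modulus i) c v = of_bool (v = None)"
| "coeff (Reduce i j) (Letter a) None = - j"
| "coeff (Reduce i j) (Letter a) (Some b) =
    (if b \<in> dependent a then 2 else 0) - of_bool (b = a)"
| "coeff (Reduce i j) Left_End v = - of_bool (v = Some (letters ! i))"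
| "coeff (Write i j) (Letter a) None = - j"
| "coeff (Write i j) (Letter a) (Some b) =
    (if b \<in> dependent a then 2 else 0) - of_bool (b = a)"
| "coeff _ _ _ = 0"

text \<open>\<open>Extend\<close> and \<open>Output\<close> store 0 as the modulus, ready for the
  next letter. \<open>Rewind\<close> clears the residues, which gives the weight of the empty
  word.\<close>

fun target :: "phase \<Rightarrow> 'a cell \<Rightarrow> 'a option set" where
  "target (Rewind i) c = Some ` A"
| "target (Reduce i j) c = {}"
| "target (Write i j) (Letter a) = {Some a}"
| "target _ _ = {None}"

text \<open>The input is read from right to left because \<open>weight\<close> applies the last
  letter first; \<open>Rewind\<close> therefore seeks the right end. \<open>Reduce\<close> lowers
  the candidate quotient until the remainder is nonnegative, then \<open>Write\<close> stores it and
  moves on. The maximum keeps \<open>j\<close> in the range allowed by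
  \<open>phases\<close>.\<close>

fun next_action :: "phase \<Rightarrow> 'a cell \<Rightarrow> int \<Rightarrow> phase \<times> move \<times> bool \<times> 'a option" where
  "next_action Count c r =
    (if c = Right_End then Extend (card A) else Count, Move_Right, r \<noteq> 0, None)"
| "next_action (Extend 0) c r = (Next_Modulus 0, Stay, True, None)"
| "next_action (Extend (Suc k)) c r = (Extend k, Stay, True, None)"
| "next_action (Next_Modulus i) c r =
    (if i = length letters then Next_Modulus i else if r = 0 then Rewind i
     else Next_Modulus (Suc i), Stay, False, None)"
| "next_action (Rewind i) Right_End r = (Reduce i max_quotient, Move_Left, False, None)"
| "next_action (Rewind i) c r = (Rewind i, Move_Right, False, None)"
| "next_action (Reduce i j) (Letter a) r =
    (if r < 0 then Reduce i (max (-1) (j - 1)) else Write i j, Stay, False, None)"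
| "next_action (Reduce i j) c r = (if r < 0 then Output i else Next_Modulus i, Stay, False, None)"
| "next_action (Write i j) c r = (Reduce i max_quotient, Move_Left, False, None)"
| "next_action (Output i) c r = (Next_Modulus (Suc i), Stay, False, Some (letters ! i))"

lemma phases_iff [simp]:
  "Count \<in> phases" "Extend k \<in> phases \<longleftrightarrow> k \<le> card A"
  "Next_Modulus i \<in> phases \<longleftrightarrow> i \<le> length letters"
  "Rewind i \<in> phases \<longleftrightarrow> i < length letters" "Output i \<in> phases \<longleftrightarrow> i < length letters"
  "Reduce i j \<in> phases \<longleftrightarrow> i < length letters \<and> -1 \<le> j \<and> j \<le> max_quotient"
  "Write i j \<in> phases \<longleftrightarrow> i < length letters \<and> -1 \<le> j \<and> j \<le> max_quotient"
  by (auto simp: phases_def image_iff)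

lemma max_quotient_ge: "-1 \<le> max_quotient"
  by (simp add: max_quotient_def)

sublocale sweep_program A A registers phases Count "{Next_Modulus (length letters)}" const coeff
  target next_action
proof
  show "finite A" "finite registers" "finite phases"
    by (auto simp: finite_A registers_def phases_def)
  show "Count \<in> phases" "{Next_Modulus (length letters)} \<subseteq> phases" by auto
  fix q c r q' d e out
  assume "q \<in> phases" "c \<in> input_cells A" and "next_action q c r = (q', d, e, out)"
  then show "q' \<in> phases \<and> set_option out \<subseteq> A"
    using max_quotient_ge nth_mem[of _ letters]
    by (induction q c r rule: next_action.induct) (auto simp: set_letters split: if_splits)
qed

lemma result_eq:
  "result q c x = const q c + coeff q c None * x None + (\<Sum>a\<in>A. coeff q c (Some a) * x (Some a))"
proof -
  have "(\<Sum>v\<in>registers. coeff q c v * x v) =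
      coeff q c None * x None + (\<Sum>a\<in>A. coeff q c (Some a) * x (Some a))"
    by (simp add: registers_def finite_A sum.reindex)
  then show ?thesis by (simp add: result_def)
qed

lemma sweep_stepI:
  assumes "q \<noteq> Next_Modulus (length letters)"
    and "next_action q (input_cell w p) (result q (input_cell w p) x div 2 ^ L) = (q', d, e, out')"
    and "p' = min (length w + 1) (move_head d p)" and "L' = (if e then Suc L else L)"
    and "x' = update q (input_cell w p) L x"
    and "out'' = out @ (case out' of None \<Rightarrow> [] | Some b \<Rightarrow> [b])"
  shows "sweep_step w (q, p, L, x, out) (q', p', L', x', out'')"
  unfolding assms(3-) using assms(1,2) by (intro sweep_step.intros) auto

subsection \<open>Allocating the work tape\<close>

text \<open>
  The counter overflows when the head reaches position \<open>2 ^ L - 1\<close>, after \<open>L\<close> cells have been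
  allocated.
\<close>

definition counts :: "nat \<Rightarrow> nat \<Rightarrow> ('a option \<Rightarrow> int) \<Rightarrow> bool" where
  "counts p L x \<longleftrightarrow> int p + 1 = 2 ^ L + x None \<and> 0 \<le> x None \<and> x None < 2 ^ L"

text \<open>The counter is \<open>p + 1\<close> without its leading binary digit. On overflow it
  wraps to 0 and the leading digit moves up one place.\<close>

lemma count_step:
  assumes "counts p L x" and "p \<le> length w + 1"
  shows "\<exists>L' x'. counts (Suc p) L' x' \<and> sweep_step w (Count, p, L, x, out)
    (if input_cell w p = Right_End then Extend (card A) else Count, min (length w + 1) (Suc p),
     L', x', out)"
proof -
  let ?c = "input_cell w p"
  define e where "e \<longleftrightarrow> x None + 1 = 2 ^ L"
  have r: "result Count ?c x = x None + 1" by (simp add: result_eq)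
  have "(x None + 1) div 2 ^ L = of_bool e" "(x None + 1) mod 2 ^ L = (if e then 0 else x None + 1)"
    using assms(1) by (auto simp: counts_def e_def)
  then have "counts (Suc p) (if e then Suc L else L) (update Count ?c L x)"
    using assms(1) by (auto simp: counts_def update_def r e_def)
  moreover have "sweep_step w (Count, p, L, x, out)
    (if ?c = Right_End then Extend (card A) else Count, min (length w + 1) (Suc p),
     if e then Suc L else L, update Count ?c L x, out)"
    using \<open>(x None + 1) div 2 ^ L = of_bool e\<close>
    by (intro sweep_stepI[where d = Move_Right and e = e and out' = None]) (auto simp: r)
  ultimately show ?thesis by blast
qed

lemma input_cell_eq_Right_End_iff: "input_cell w p = Right_End \<longleftrightarrow> length w < p"
  by (auto simp: input_cell_def)

lemma count_steps:
  "p \<le> length w + 1 \<Longrightarrow>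
    \<exists>L x. counts p L x \<and> (sweep_step w)\<^sup>*\<^sup>* (Count, 0, 0, \<lambda>_. 0, []) (Count, p, L, x, [])"
proof (induction p)
  case 0
  have "counts 0 0 (\<lambda>_. 0)" by (simp add: counts_def)
  then show ?case by blast
next
  case (Suc p)
  then obtain L x where "counts p L x"
    and steps: "(sweep_step w)\<^sup>*\<^sup>* (Count, 0, 0, \<lambda>_. 0, []) (Count, p, L, x, [])" by auto
  from count_step[OF this(1), of w "[]"] Suc.prems obtain L' x' where "counts (Suc p) L' x'"
    "sweep_step w (Count, p, L, x, []) (Count, Suc p, L', x', [])"
    by (auto simp: input_cell_eq_Right_End_iff)
  with steps show ?case by (meson rtranclp.rtrancl_into_rtrancl)
qed

lemma extend_steps:
  "p \<le> length w + 1 \<Longrightarrow>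
    \<exists>x'. x' None = 0 \<and> (sweep_step w)\<^sup>*\<^sup>* (Extend k, p, L, x, out)
      (Next_Modulus 0, p, L + Suc k, x', out)"
proof (induction k arbitrary: L x)
  case 0
  let ?x = "update (Extend 0) (input_cell w p) L x"
  have "sweep_step w (Extend 0, p, L, x, out) (Next_Modulus 0, p, Suc L, ?x, out)"
    using 0 by (intro sweep_stepI[where d = Stay and e = True and out' = None]) auto
  moreover have "?x None = 0" by (simp add: update_def result_eq)
  ultimately show ?case by (intro exI[of _ ?x]) auto
next
  case (Suc k)
  let ?x = "update (Extend (Suc k)) (input_cell w p) L x"
  have "sweep_step w (Extend (Suc k), p, L, x, out) (Extend k, p, Suc L, ?x, out)"
    using Suc by (intro sweep_stepI[where d = Stay and e = True and out' = None]) auto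
  moreover obtain x' where "x' None = 0" "(sweep_step w)\<^sup>*\<^sup>* (Extend k, p, Suc L, ?x, out)
      (Next_Modulus 0, p, L + Suc (Suc k), x', out)"
    using Suc.IH[OF Suc.prems, of "Suc L" ?x] by auto
  ultimately show ?case by (meson converse_rtranclp_into_rtranclp)
qed

text \<open>The right end cell is counted too, so \<open>p\<close> reaches
  \<open>length w + 2\<close> and \<open>L\<close> is the integer part of the binary logarithm of
  \<open>length w + 3\<close>. The further cells make the moduli large enough for
  \<open>weight_nonzero_iff\<close>.\<close>

lemma allocation_steps:
  "\<exists>p L x. 2 ^ L \<le> length w + 3 \<and> length w + 3 < 2 ^ Suc L \<and> p \<le> length w + 1 \<and> x None = 0 \<and>
    (sweep_step w)\<^sup>*\<^sup>* (Count, 0, 0, \<lambda>_. 0, []) (Next_Modulus 0, p, L + Suc (card A), x, [])"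
proof -
  let ?p = "length w + 1"
  obtain L x where "counts ?p L x"
    and s1: "(sweep_step w)\<^sup>*\<^sup>* (Count, 0, 0, \<lambda>_. 0, []) (Count, ?p, L, x, [])"
    using count_steps[of ?p w] by auto
  from count_step[OF this(1), of w "[]"] obtain L' x' where L': "counts (Suc ?p) L' x'"
    and s2: "sweep_step w (Count, ?p, L, x, []) (Extend (card A), ?p, L', x', [])"
    by (auto simp: input_cell_eq_Right_End_iff)
  obtain x'' where x'': "x'' None = 0"
    and s3: "(sweep_step w)\<^sup>*\<^sup>* (Extend (card A), ?p, L', x', [])
      (Next_Modulus 0, ?p, L' + Suc (card A), x'', [])"
    using extend_steps[of ?p w] by blast
  have "int (2 ^ L') \<le> int (length w + 3)" "int (length w + 3) < int (2 ^ Suc L')"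
    using L' by (simp_all add: counts_def)
  then have "2 ^ L' \<le> length w + 3" "length w + 3 < 2 ^ Suc L'"
    by (simp_all only: of_nat_le_iff of_nat_less_iff)
  with s1 s2 s3 x'' show ?thesis
    by (meson order.refl converse_rtranclp_into_rtranclp rtranclp_trans)
qed

subsection \<open>Computing the weight modulo the content of the register\<close>

lemma result_reflect:
  assumes "a \<in> A" and "q = Reduce i j \<or> q = Write i j"
  shows "result q (Letter a) x = reflect a (\<lambda>b. x (Some b)) a - j * x None"
proof -
  have "(\<Sum>b\<in>A. coeff q (Letter a) (Some b) * x (Some b)) =
      (\<Sum>b\<in>A. (if b \<in> dependent a then 2 * x (Some b) else 0) -
        (if b = a then x (Some b) else 0))"
    using assms(2) by (intro sum.cong) auto
  also have "\<dots> = (\<Sum>b\<in>A. if b \<in> dependent a then 2 * x (Some b) else 0) -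
      (\<Sum>b\<in>A. if b = a then x (Some b) else 0)"
    by (rule sum_subtractf)
  also have "(\<Sum>b\<in>A. if b = a then x (Some b) else 0) = x (Some a)"
    using assms(1) finite_A by simp
  also have "(\<Sum>b\<in>A. if b \<in> dependent a then 2 * x (Some b) else 0) =
      (\<Sum>b\<in>dependent a. 2 * x (Some b))"
    using finite_A by (subst sum.inter_filter[symmetric]) (auto simp: dependent_def intro!: sum.cong)
  finally show ?thesis
    using assms(2) by (auto simp: result_eq reflect_eq sum_distrib_left)
qed

text \<open>Division by trial: a candidate above the quotient leaves a negative remainder and is
  lowered by one.\<close>

lemma reduce_steps:
  assumes c: "input_cell w p = Letter a" "a \<in> A" and i: "i < length letters"
    and p: "0 < p" "p \<le> length w + 1" and m: "0 < x None" "x None < 2 ^ L"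
    and t: "t = reflect a (\<lambda>b. x (Some b)) a" and j: "t div x None \<le> j" "- x None < t"
  shows "(sweep_step w)\<^sup>*\<^sup>* (Reduce i j, p, L, x, out)
    (Reduce i max_quotient, p - 1, L, x(Some a := t mod x None), out)"
  using j(1)
proof (induction "nat (j - t div x None)" arbitrary: j)
  case 0
  then have j_eq: "j = t div x None" by simp
  \<comment> \<open>At the true quotient the remainder is the residue, which fits into
    \<open>L\<close> bits: the carry is 0 and storing it loses nothing.\<close>
  have mod: "t - j * x None = t mod x None"
    unfolding j_eq by (rule minus_div_mult_eq_mod)
  have "0 \<le> t mod x None" "t mod x None < 2 ^ L"
    using m(1) less_trans[OF pos_mod_bound[OF m(1)] m(2)] by simp_all
  then have r: "(t mod x None) div 2 ^ L = 0" "t mod x None mod 2 ^ L = t mod x None" by auto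
  have "sweep_step w (Reduce i j, p, L, x, out) (Write i j, p, L, x, out)"
    using p c r result_reflect[OF c(2), of "Reduce i j" i j x] mod
    by (intro sweep_stepI[where d = Stay and e = False and out' = None])
      (auto simp: t update_def)
  moreover have "sweep_step w (Write i j, p, L, x, out)
      (Reduce i max_quotient, p - 1, L, x(Some a := t mod x None), out)"
    using p c r result_reflect[OF c(2), of "Write i j" i j x] mod
    by (intro sweep_stepI[where d = Move_Left and e = False and out' = None])
      (auto simp: t update_def)
  ultimately show ?case by (meson converse_rtranclp_into_rtranclp r_into_rtranclp)
next
  case (Suc k)
  then have j_gt: "t div x None < j" by linarith
  \<comment> \<open>The quotient is at least -1, so the cut-off at -1 does not interfere while
    \<open>j\<close> exceeds the quotient.\<close>
  have "-1 \<le> t div x None"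
    using zdiv_mono1[of "- x None" t "x None"] j(2) m(1)
    by (simp add: zdiv_zminus1_eq_if)
  then have max: "max (-1) (j - 1) = j - 1" using j_gt by simp
  have "t div x None + 1 \<le> j" using j_gt by simp
  then have "(t div x None + 1) * x None \<le> j * x None"
    using m by (intro mult_right_mono) auto
  moreover have "t < (t div x None + 1) * x None"
    using pos_mod_bound[OF m(1), of t] div_mult_mod_eq[of t "x None"]
    unfolding distrib_right by linarith
  ultimately have "(t - j * x None) div 2 ^ L < 0"
    by (intro div_neg_pos_less0) auto
  then have "next_action (Reduce i j) (input_cell w p)
      (result (Reduce i j) (input_cell w p) x div 2 ^ L) = (Reduce i (j - 1), Stay, False, None)"
    using result_reflect[OF c(2), of "Reduce i j" i j x] unfolding c(1) t[symmetric] next_action.simps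
    by (simp only: max if_True simp_thms)
  then have "sweep_step w (Reduce i j, p, L, x, out) (Reduce i (j - 1), p, L, x, out)"
    using p by (intro sweep_stepI) (auto simp: update_def)
  moreover have "(sweep_step w)\<^sup>*\<^sup>* (Reduce i (j - 1), p, L, x, out)
      (Reduce i max_quotient, p - 1, L, x(Some a := t mod x None), out)"
    using Suc.hyps(2) j_gt by (intro Suc.hyps(1)) auto
  ultimately show ?case by (rule converse_rtranclp_into_rtranclp)
qed

definition residues :: "int \<Rightarrow> 'a list \<Rightarrow> ('a option \<Rightarrow> int) \<Rightarrow> bool" where
  "residues m u x \<longleftrightarrow> x None = m \<and> (\<forall>a\<in>A. x (Some a) = weight u a mod m)"

text \<open>Input cell \<open>Suc p\<close> holds \<open>w ! p\<close>, so a head in cell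
  \<open>p\<close> means that the suffix \<open>drop p w\<close> has been processed.\<close>

lemma letter_steps:
  assumes w: "w \<in> lists A" and p: "p < length w" and i: "i < length letters"
    and m: "0 < m" "m < 2 ^ L" and x: "residues m (drop (Suc p) w) x"
  shows "\<exists>x'. residues m (drop p w) x' \<and> (sweep_step w)\<^sup>*\<^sup>*
    (Reduce i max_quotient, Suc p, L, x, out) (Reduce i max_quotient, p, L, x', out)"
proof -
  let ?a = "w ! p"
  let ?n = "weight (drop (Suc p) w)"
  define t where "t = reflect ?a (\<lambda>b. x (Some b)) ?a"
  have a: "?a \<in> A" using w p by (auto simp: in_lists_conv_set)
  have c: "input_cell w (Suc p) = Letter ?a" using p by (simp add: input_cell_def)
  have x_Some: "x (Some b) = ?n b mod m" if "b \<in> A" for b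
    using x that by (auto simp: residues_def)
  have x_None: "x None = m" using x by (simp add: residues_def)
  have range: "0 \<le> x (Some b)" "x (Some b) \<le> m - 1" if "b \<in> A" for b
    using m that by (auto simp: x_Some)
  have dep: "b \<in> A" if "b \<in> dependent ?a" for b using that by (simp add: dependent_def)
  have "0 \<le> (\<Sum>b\<in>dependent ?a. x (Some b))"
    using range dep by (intro sum_nonneg) auto
  then have lower: "- m < t"
    using range[OF a] by (simp add: t_def reflect_eq)
  have "(\<Sum>b\<in>dependent ?a. x (Some b)) \<le> (\<Sum>b\<in>dependent ?a. m - 1)"
    using range dep by (intro sum_mono) auto
  also have "\<dots> \<le> (\<Sum>b\<in>A. m - 1)"
    using dep m by (intro sum_mono2 finite_A) auto
  finally have "t \<le> 1 + 2 * (int (card A) * (m - 1))"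
    using range[OF a] by (simp add: t_def reflect_eq)
  also have "\<dots> \<le> max_quotient * m"
    using m by (simp add: max_quotient_def algebra_simps)
  finally have "t div m \<le> max_quotient * m div m"
    using m by (intro zdiv_mono1) auto
  then have upper: "t div m \<le> max_quotient" using m by simp
  \<comment> \<open>Reflections are affine with integer coefficients, hence compatible with
    reduction modulo \<open>m\<close>.\<close>
  have "t mod m = reflect ?a ?n ?a mod m"
  proof -
    have "(\<Sum>b\<in>dependent ?a. x (Some b)) mod m = (\<Sum>b\<in>dependent ?a. ?n b) mod m"
      using dep by (subst mod_sum_eq[symmetric], subst (2) mod_sum_eq[symmetric])
        (simp add: x_Some)
    then have "(1 - ?n ?a mod m + 2 * (\<Sum>b\<in>dependent ?a. x (Some b))) mod m =
        (1 - ?n ?a + 2 * (\<Sum>b\<in>dependent ?a. ?n b)) mod m"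
      by (intro mod_add_cong mod_mult_cong) (simp_all add: mod_simps)
    then show ?thesis
      by (simp add: t_def reflect_eq x_Some[OF a])
  qed
  moreover have "drop p w = ?a # drop (Suc p) w"
    using p by (rule Cons_nth_drop_Suc[symmetric])
  ultimately have "residues m (drop p w) (x(Some ?a := t mod m))"
    using x by (auto simp: residues_def reflect_def)
  moreover have "(sweep_step w)\<^sup>*\<^sup>* (Reduce i max_quotient, Suc p, L, x, out)
      (Reduce i max_quotient, Suc p - 1, L, x(Some ?a := t mod x None), out)"
    using p m upper lower by (intro reduce_steps[OF c a i]) (auto simp: x_None t_def)
  ultimately show ?thesis by (auto simp: x_None)
qed

lemma word_steps:
  assumes w: "w \<in> lists A" and i: "i < length letters" and m: "0 < m" "m < 2 ^ L"
    and "p \<le> length w" and "residues m (drop p w) x"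
  shows "\<exists>x'. residues m w x' \<and> (sweep_step w)\<^sup>*\<^sup>*
    (Reduce i max_quotient, p, L, x, out) (Reduce i max_quotient, 0, L, x', out)"
  using assms(5,6)
proof (induction p arbitrary: x)
  case 0
  then show ?case by auto
next
  case (Suc p)
  then obtain x' where "residues m (drop p w) x'" "(sweep_step w)\<^sup>*\<^sup>*
    (Reduce i max_quotient, Suc p, L, x, out) (Reduce i max_quotient, p, L, x', out)"
    using letter_steps[OF w _ i m, of p x] by auto
  with Suc show ?case by (meson Suc_leD rtranclp_trans)
qed

lemma rewind_steps:
  assumes i: "i < length letters" and "p \<le> length w + 1" and x: "x None = m"
  shows "\<exists>x'. residues m [] x' \<and> (sweep_step w)\<^sup>*\<^sup>* (Rewind i, p, L, x, out)
    (Reduce i max_quotient, length w, L, x', out)"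
  using assms(2,3)
proof (induction "length w + 1 - p" arbitrary: p x)
  case 0
  let ?c = "input_cell w p"
  let ?x = "update (Rewind i) ?c L x"
  have c: "?c = Right_End" "p = length w + 1" using 0 by (auto simp: input_cell_eq_Right_End_iff)
  have "sweep_step w (Rewind i, p, L, x, out) (Reduce i max_quotient, length w, L, ?x, out)"
    by (intro sweep_stepI[where d = Move_Left and e = False and out' = None])
      (auto simp: c(1), auto simp: c(2))
  moreover have "residues m [] ?x"
    using 0 by (auto simp: residues_def update_def result_eq)
  ultimately show ?case by blast
next
  case (Suc k)
  let ?c = "input_cell w p"
  let ?x = "update (Rewind i) ?c L x"
  have c: "?c \<noteq> Right_End" using Suc by (auto simp: input_cell_eq_Right_End_iff)
  then have "next_action (Rewind i) ?c r = (Rewind i, Move_Right, False, None)" for r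
    by (cases ?c) auto
  then have "sweep_step w (Rewind i, p, L, x, out) (Rewind i, Suc p, L, ?x, out)"
    using Suc by (intro sweep_stepI[where d = Move_Right and e = False and out' = None]) auto
  moreover have k: "k = length w + 1 - Suc p" "Suc p \<le> length w + 1"
    using Suc.hyps(2) by auto
  moreover have "?x None = m"
    using Suc.prems by (auto simp: update_def)
  then obtain x' where "residues m [] x'" "(sweep_step w)\<^sup>*\<^sup>* (Rewind i, Suc p, L, ?x, out)
    (Reduce i max_quotient, length w, L, x', out)"
    using Suc.hyps(1)[OF k, of ?x] by blast
  ultimately show ?case by (meson converse_rtranclp_into_rtranclp)
qed

lemma modulus_steps:
  assumes w: "w \<in> lists A" and i: "i < length letters" and p: "p \<le> length w + 1"
    and m: "0 < m" "m < 2 ^ L" "x None = m"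
  shows "\<exists>x'. x' None = m \<and> (sweep_step w)\<^sup>*\<^sup>* (Rewind i, p, L, x, out)
    (if weight w (letters ! i) mod m \<noteq> 0 then Output i else Next_Modulus i, 0, L, x', out)"
proof -
  let ?a = "letters ! i"
  have a: "?a \<in> A" using i set_letters by auto
  obtain x1 where "residues m [] x1" and s1: "(sweep_step w)\<^sup>*\<^sup>* (Rewind i, p, L, x, out)
      (Reduce i max_quotient, length w, L, x1, out)"
    using rewind_steps[of i p w x m] i p m(3) by blast
  then obtain x2 where x2: "residues m w x2" and s2: "(sweep_step w)\<^sup>*\<^sup>*
      (Reduce i max_quotient, length w, L, x1, out) (Reduce i max_quotient, 0, L, x2, out)"
    using word_steps[OF w i m(1,2), of "length w" x1] by auto
  have c: "input_cell w 0 = Left_End" by (simp add: input_cell_def)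
  have xa: "x2 (Some ?a) = weight w ?a mod m" using x2 a by (simp add: residues_def)
  then have xa_bounds: "0 \<le> x2 (Some ?a)" "x2 (Some ?a) < 2 ^ L"
    using m(1) less_trans[OF pos_mod_bound[OF m(1)] m(2)] by simp_all
  have "result (Reduce i max_quotient) Left_End x2 = - x2 (Some ?a)"
    using a finite_A by (simp add: result_eq sum_negf)
  moreover have "- x2 (Some ?a) div 2 ^ L < 0 \<longleftrightarrow> x2 (Some ?a) \<noteq> 0"
    using xa_bounds(1) by (auto intro: div_neg_pos_less0)
  ultimately have s3: "sweep_step w (Reduce i max_quotient, 0, L, x2, out)
      (if weight w ?a mod m \<noteq> 0 then Output i else Next_Modulus i, 0, L, x2, out)"
    by (intro sweep_stepI[where d = Stay and e = False and out' = None])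
      (auto simp: c xa update_def)
  have "x2 None = m" using x2 by (simp add: residues_def)
  with rtranclp.rtrancl_into_rtrancl[of "sweep_step w", OF rtranclp_trans[of "sweep_step w", OF s1 s2] s3]
  show ?thesis by blast
qed

subsection \<open>Trying all moduli\<close>

text \<open>Induction on the number of moduli left. The first witness ends the search, so the letter
  is written at most once.\<close>

lemma next_letter_steps:
  assumes w: "w \<in> lists A" and i: "i < length letters"
    and "p \<le> length w + 1" and "x None = m" and "0 \<le> m" and "m < 2 ^ L"
  shows "\<exists>p' x'. p' \<le> length w + 1 \<and> x' None = 0 \<and>
    (sweep_step w)\<^sup>*\<^sup>* (Next_Modulus i, p, L, x, out) (Next_Modulus (Suc i), p', L, x',
      out @ (if \<exists>n>m. n < 2 ^ L \<and> weight w (letters ! i) mod n \<noteq> 0 then [letters ! i] else []))"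
  using assms(3-)
proof (induction "nat (2 ^ L - 1 - m)" arbitrary: p x m)
  case 0
  \<comment> \<open>The last modulus is \<open>2 ^ L - 1\<close>; the next increment overflows, and
    the register wraps to 0 for the next letter.\<close>
  then have m: "m + 1 = 2 ^ L" by linarith
  let ?x = "update (Next_Modulus i) (input_cell w p) L x"
  have r: "result (Next_Modulus i) (input_cell w p) x = 2 ^ L"
    using 0 m by (simp add: result_eq add.commute)
  have "sweep_step w (Next_Modulus i, p, L, x, out) (Next_Modulus (Suc i), p, L, ?x, out)"
    using 0 i by (intro sweep_stepI[where d = Stay and e = False and out' = None]) (auto simp: r)
  moreover have "?x None = 0" by (simp add: update_def r)
  moreover have "\<not> (\<exists>n>m. n < 2 ^ L \<and> weight w (letters ! i) mod n \<noteq> 0)" using m by auto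
  ultimately show ?case using 0 by (intro exI[of _ p] exI[of _ ?x])
      (simp only: if_False append_Nil2 simp_thms r_into_rtranclp)
next
  case (Suc k)
  then have m: "m + 1 < 2 ^ L" by linarith
  let ?a = "letters ! i"
  let ?x = "update (Next_Modulus i) (input_cell w p) L x"
  have r: "result (Next_Modulus i) (input_cell w p) x = m + 1"
    using Suc by (simp add: result_eq)
  have "(m + 1) div 2 ^ L = 0" using m Suc.prems by simp
  then have s1: "sweep_step w (Next_Modulus i, p, L, x, out) (Rewind i, p, L, ?x, out)"
    using Suc i by (intro sweep_stepI[where d = Stay and e = False and out' = None]) (auto simp: r)
  have "?x None = m + 1" using m Suc.prems by (simp add: update_def r)
  then obtain x' where x': "x' None = m + 1" and s2: "(sweep_step w)\<^sup>*\<^sup>* (Rewind i, p, L, ?x, out)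
    (if weight w ?a mod (m + 1) \<noteq> 0 then Output i else Next_Modulus i, 0, L, x', out)"
    using modulus_steps[OF w i, of p "m + 1" L ?x out] m Suc.prems by auto
  show ?case
  proof (cases "weight w ?a mod (m + 1) = 0")
    case True
    have "m < n \<longleftrightarrow> n = m + 1 \<or> m + 1 < n" for n by auto
    with True have ex: "(\<exists>n>m. n < 2 ^ L \<and> weight w ?a mod n \<noteq> 0) \<longleftrightarrow>
        (\<exists>n>m + 1. n < 2 ^ L \<and> weight w ?a mod n \<noteq> 0)"
      by metis
    have k: "k = nat (2 ^ L - 1 - (m + 1))" "0 \<le> m + 1"
      using Suc.hyps(2) Suc.prems by linarith+
    have s: "(sweep_step w)\<^sup>*\<^sup>* (Next_Modulus i, p, L, x, out) (Next_Modulus i, 0, L, x', out)"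
      using converse_rtranclp_into_rtranclp[of "sweep_step w", OF s1 s2] True by simp
    show ?thesis
      unfolding ex
      using Suc.hyps(1)[of "m + 1" 0 x', OF k(1) _ x' k(2) m]
        rtranclp_trans[of "sweep_step w", OF s]
      by blast
  next
    case False
    let ?y = "update (Output i) (input_cell w 0) L x'"
    have "sweep_step w (Output i, 0, L, x', out) (Next_Modulus (Suc i), 0, L, ?y, out @ [?a])"
      by (intro sweep_stepI[where d = Stay and e = False and out' = "Some ?a"]) auto
    moreover have "(sweep_step w)\<^sup>*\<^sup>* (Next_Modulus i, p, L, x, out) (Output i, 0, L, x', out)"
      using converse_rtranclp_into_rtranclp[of "sweep_step w", OF s1 s2] False by simp
    ultimately have "(sweep_step w)\<^sup>*\<^sup>* (Next_Modulus i, p, L, x, out)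
        (Next_Modulus (Suc i), 0, L, ?y, out @ [?a])"
      by (meson rtranclp.rtrancl_into_rtrancl)
    moreover have "\<exists>n>m. n < 2 ^ L \<and> weight w ?a mod n \<noteq> 0"
      using False m by (intro exI[of _ "m + 1"]) auto
    moreover have "?y None = 0" by (simp add: update_def result_eq)
    ultimately show ?thesis by (intro exI[of _ 0] exI[of _ ?y]) simp
  qed
qed

lemma all_letters_steps:
  assumes w: "w \<in> lists A" and "p \<le> length w + 1" and "x None = 0"
    and i: "i \<le> length letters"
  shows "\<exists>p' x'. p' \<le> length w + 1 \<and> x' None = 0 \<and>
    (sweep_step w)\<^sup>*\<^sup>* (Next_Modulus 0, p, L, x, []) (Next_Modulus i, p', L, x',
      filter (\<lambda>a. \<exists>n>0. n < 2 ^ L \<and> weight w a mod n \<noteq> 0) (take i letters))"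
  using i
proof (induction i)
  case 0
  then show ?case using assms by (intro exI[of _ p] exI[of _ x]) simp
next
  case (Suc i)
  then obtain p' x' where p': "p' \<le> length w + 1" "x' None = 0"
    and s1: "(sweep_step w)\<^sup>*\<^sup>* (Next_Modulus 0, p, L, x, []) (Next_Modulus i, p', L, x',
      filter (\<lambda>a. \<exists>n>0. n < 2 ^ L \<and> weight w a mod n \<noteq> 0) (take i letters))"
    by auto
  let ?out = "filter (\<lambda>a. \<exists>n>0. n < 2 ^ L \<and> weight w a mod n \<noteq> 0) (take i letters)"
  have i: "i < length letters" using Suc by simp
  obtain p'' x'' where p'': "p'' \<le> length w + 1" "x'' None = 0" and s2: "(sweep_step w)\<^sup>*\<^sup>*
      (Next_Modulus i, p', L, x', ?out) (Next_Modulus (Suc i), p'', L, x'', ?out @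
        (if \<exists>n>0. n < 2 ^ L \<and> weight w (letters ! i) mod n \<noteq> 0 then [letters ! i] else []))"
    using next_letter_steps[of w i p' x' 0 L ?out] w i p' by auto
  have out: "?out @
      (if \<exists>n>0. n < 2 ^ L \<and> weight w (letters ! i) mod n \<noteq> 0 then [letters ! i] else []) =
      filter (\<lambda>a. \<exists>n>0. n < 2 ^ L \<and> weight w a mod n \<noteq> 0) (take (Suc i) letters)"
    using i by (auto simp: take_Suc_conv_app_nth)
  show ?case
    using p'' rtranclp_trans[of "sweep_step w", OF s1 s2] unfolding out by blast
qed

text \<open>With \<open>k = card A\<close> and \<open>k + 1 \<le> 2 ^ k\<close>, the weight is below
  \<open>2 ^ ((k + 1) * length w)\<close>. The \<open>k + 1\<close> extra cells raise
  \<open>2 ^ L\<close> to at least \<open>(k + 1) * (length w + 3)\<close>, which covers this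
  exponent plus 2, as \<open>nonzero_mod_witness\<close> demands.\<close>

lemma weight_nonzero_iff:
  assumes w: "w \<in> lists A" and L: "length w + 3 < 2 ^ Suc L"
  shows "(\<exists>n>0. n < 2 ^ (L + Suc (card A)) \<and> weight w a mod n \<noteq> 0) \<longleftrightarrow> weight w a \<noteq> 0"
proof
  assume nz: "weight w a \<noteq> 0"
  let ?k = "card A"
  have k: "?k + 1 \<le> 2 ^ ?k"
    using less_exp[of ?k] by (simp only: Suc_eq_plus1[symmetric] Suc_le_eq)
  have "(?k + 1) * length w + 2 \<le> (?k + 1) * (length w + 3)"
    by (simp add: algebra_simps)
  also have "\<dots> \<le> 2 ^ ?k * 2 ^ Suc L"
    using k L by (intro mult_mono) auto
  also have "\<dots> = 2 ^ (L + Suc ?k)" by (simp add: power_add)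
  finally have e: "(?k + 1) * length w \<le> 2 ^ (L + Suc ?k) - 2" by simp
  have "int (?k + 1) \<le> int (2 ^ ?k)" using k by (simp only: of_nat_le_iff)
  then have "2 * int ?k + 2 \<le> 2 ^ (?k + 1)" by simp
  then have "(2 * int ?k + 2) ^ length w \<le> (2 ^ (?k + 1)) ^ length w"
    by (intro power_mono) auto
  also have "\<dots> = 2 ^ ((?k + 1) * length w)" by (rule power_mult[symmetric])
  also have "\<dots> \<le> 2 ^ (2 ^ (L + Suc ?k) - 2)"
    using e by (intro power_increasing) auto
  finally have "\<bar>weight w a\<bar> < 2 ^ (2 ^ (L + Suc ?k) - 2)"
    using abs_weight_less[OF w, of a] by linarith
  then show "\<exists>n>0. n < 2 ^ (L + Suc ?k) \<and> weight w a mod n \<noteq> 0"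
    using nz by (intro nonzero_mod_witness) auto
qed auto

theorem logspace_computable_coxeter_alphabet:
  "logspace_computable A A (\<lambda>w. filter (\<lambda>a. a \<in> coxeter_alphabet A I w) letters)"
proof (rule logspace_computable_if_sweep_program)
  \<comment> \<open>The final width is \<open>L + card A + 1\<close> with \<open>L\<close> at most
    the logarithm, and \<open>Suc\<close> of the width must stay below the bound.\<close>
  let ?S = "\<lambda>n. nat \<lfloor>log 2 (real n + 3)\<rfloor> + card A + 3"
  fix w assume w: "w \<in> lists A"
  obtain p L x where L: "2 ^ L \<le> length w + 3" "length w + 3 < 2 ^ Suc L"
    and p: "p \<le> length w + 1" and x: "x None = 0"
    and s1: "(sweep_step w)\<^sup>*\<^sup>* (Count, 0, 0, \<lambda>_. 0, []) (Next_Modulus 0, p, L + Suc (card A), x, [])"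
    using allocation_steps by blast
  let ?L = "L + Suc (card A)"
  obtain p' x' where "(sweep_step w)\<^sup>*\<^sup>* (Next_Modulus 0, p, ?L, x, [])
      (Next_Modulus (length letters), p', ?L, x',
        filter (\<lambda>a. \<exists>n>0. n < 2 ^ ?L \<and> weight w a mod n \<noteq> 0) letters)"
    using all_letters_steps[of w p x "length letters" ?L] w p x by auto
  then have s2: "(sweep_step w)\<^sup>*\<^sup>* (Next_Modulus 0, p, ?L, x, [])
      (Next_Modulus (length letters), p', ?L, x', filter (\<lambda>a. a \<in> coxeter_alphabet A I w) letters)"
    using weight_nonzero_iff[OF w L(2)] by (simp add: coxeter_alphabet_weight[OF w])
  have "2 ^ L \<le> real (length w) + 3"
    using L(1) by (metis of_nat_add of_nat_le_iff of_nat_numeral of_nat_power)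
  then have "real L \<le> log 2 (real (length w) + 3)"
    by (simp add: le_log_iff powr_realpow)
  then have "Suc ?L < ?S (length w)" by linarith
  with rtranclp_trans[OF s1 s2] show "\<exists>q p L x. q \<in> {Next_Modulus (length letters)} \<and>
      Suc L < ?S (length w) \<and> (sweep_step w)\<^sup>*\<^sup>* (Count, 0, 0, \<lambda>_. 0, [])
        (q, p, L, x, filter (\<lambda>a. a \<in> coxeter_alphabet A I w) letters)"
    by blast
next
  have "(\<lambda>n. log 2 (real n + 3) + real (card A) + 3) \<in> O(\<lambda>n. ln (real n))"
    by real_asymp
  moreover have "(\<lambda>n. real (nat \<lfloor>log 2 (real n + 3)\<rfloor> + card A + 3)) \<in>
      O(\<lambda>n. log 2 (real n + 3) + real (card A) + 3)"
    by (intro bigoI[of _ 1] always_eventually allI) (simp add: le_nat_floor)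
  ultimately show "(\<lambda>n. real (nat \<lfloor>log 2 (real n + 3)\<rfloor> + card A + 3)) \<in> O(\<lambda>n. ln (real n))"
    by (rule landau_o.big_trans[rotated])
qed

end

theorem corollary1:
  fixes A :: "'a set" and I :: "('a \<times> 'a) set" and as :: "'a list"
  assumes "independence_alphabet A I"
    and "distinct as" and "set as = A"
  shows "logspace_computable A A (\<lambda>w. filter (\<lambda>a. a \<in> coxeter_alphabet A I w) as)"
proof -
  interpret enumerated_alphabet A I as
    by unfold_locales (use assms in auto)
  show ?thesis by (rule logspace_computable_coxeter_alphabet)
qed

end
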